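(* Let $q>3$ be a prime power, $m\geq q$, and $n=\frac{q^m-1}{q-1}$. Write $m-1=a(q-1)+b$ with integers $a\geq 1$ and $0\leq b\leq q-2$. Let $\delta_{2,n}$ be the second largest $q$-cyclotomic coset leader modulo $n$. (1) If $a\geq 3$ and $b=0$, i.e., $m=a(q-1)+1$, then $$\delta_{2,n}=\frac{q^m-1-q^{m-1}-q^{m-a}-\sum_{l=1}^{q-3}q^{al-1}}{q-1}$$ and $|C_{\delta_{2,n}}|=m$. (2) If $b=1$, i.e., $m=a(q-1)+2$, let $A=\left\lfloor\frac{q-1}{2}\right\rfloor$; then $$\delta_{2,n}=\frac{q^m-1-q^{m-1}-\sum_{l=1}^{A-1}q^{al}-\sum_{l=A}^{q-2}q^{al+1}}{q-1}$$ and $|C_{\delta_{2,n}}|=m$. (3) If $b=2$, i.e., $m=a(q-1)+3$, let $A=\left\lfloor\frac{q-1}{3}\right\rfloor$ and $D=\frac{q^{m}-1-\sum_{t=1}^{q-1}q^{\lceil \frac{mt}{q-1}-1\rceil}}{q-1}$; then $$\delta_{2,n}=\begin{cases} D-q^{(2A+1)a+1}+q^{(A+1)a}, & \text{if } q\equiv 0\pmod 3,\\ D-q^{2Aa+1}, & \text{if } q\equiv 1\pmod 3,\\ D-q^{Aa}, & \text{if } q\equiv 2\pmod 3,\end{cases}$$ and $|C_{\delta_{2,n}}|=m$.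
   Context: For $0\le t\le n-1$, the $q$-cyclotomic coset of $t$ modulo $n$ is $C_t=\{tq^j\bmod n: 0\le j<m\}\subseteq\{0,\dots,n-1\}$; its smallest element is its coset leader. $\delta_{2,n}$ denotes the second largest element of the set of all $q$-cyclotomic coset leaders modulo $n$. *)

theory Defs
  imports Complex_Main "HOL-Number_Theory.Number_Theory" "HOL-Number_Theory.Prime_Powers"
begin

definition cyclotomic_coset :: "nat \<Rightarrow> nat \<Rightarrow> nat \<Rightarrow> nat \<Rightarrow> nat set" where
  "cyclotomic_coset q m n t = {t * q ^ j mod n | j. j < m}"

definition coset_leaders :: "nat \<Rightarrow> nat \<Rightarrow> nat \<Rightarrow> nat set" where
  "coset_leaders q m n = {Min (cyclotomic_coset q m n t) | t. t < n}"

(* Meaningful for finite sets with at least two elements. For q \<ge> 2, m \<ge> 2 and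
   n = 1 + q + ... + q^(m-1), the numbers 0 and 1 are always coset leaders. *)
definition second_largest :: "nat set \<Rightarrow> nat" where
  "second_largest S = Max (S - {Max S})"

definition delta2 :: "nat \<Rightarrow> nat \<Rightarrow> nat \<Rightarrow> nat" where
  "delta2 q m n = second_largest (coset_leaders q m n)"

end

theory Submission
  imports Defs "HOL-Library.Infinite_Set"
begin

text \<open>
  For \<open>x < n\<close> put \<open>z = (q - 1) * (n - x) = q ^ m - 1 - (q - 1) * x\<close> and write \<open>z\<close> as a
  \<open>q\<close>-ary word of length \<open>m\<close>. Multiplying \<open>x\<close> by \<open>q\<close> modulo \<open>n\<close> rotates this word, so \<open>x\<close> is a
  coset leader iff the word is maximal among its rotations, and large leaders correspond to small
  maximal words. The divisibility of \<open>z\<close> by \<open>q - 1\<close> says that \<open>q - 1\<close> divides the digit sum.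

  The smallest such words have digits 0 and 1 only, and are given by the positions
  \<open>s 0 = 0 < s 1 < ...\<close> of their ones, counted from the most significant digit and extended
  periodically. Smaller words have lexicographically larger position sequences. The number of
  ones is a multiple of \<open>k = q - 1\<close>, and \<open>2 * k\<close> or more of them would be too close together, so
  there are \<open>k\<close> ones with average distance \<open>m / k\<close>; the balanced sequence \<open>t * m div k\<close> gives the largest leader. The runner-up is found by writing
  \<open>s t = a * t + E t\<close>: for \<open>b = 1, 2\<close> all distances are at least \<open>a\<close>, so \<open>E\<close> is a monotone step function
  with \<open>b + 1\<close> jumps per period, and comparing it with its shifts leaves two choices of the jump
  positions. For \<open>b = 0\<close> the runner-up has distances \<open>a - 1, a + 2, a, ..., a\<close>.
\<close>

section \<open>Words and their rotations\<close>

text \<open>Words are infinite and \<open>m\<close>-periodic, so that a rotation is the window of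
  length \<open>m\<close> starting at \<open>r\<close>, most significant letter first, and no index
  is reduced modulo \<open>m\<close>.\<close>

primrec rot :: "nat \<Rightarrow> nat \<Rightarrow> (nat \<Rightarrow> nat) \<Rightarrow> nat \<Rightarrow> nat" where
  "rot q 0 w r = 0"
| "rot q (Suc k) w r = q * rot q k w r + w (r + k)"

lemma rot_less:
  assumes "\<And>i. w i < q"
  shows "rot q k w r < q ^ k"
proof (induction k)
  case (Suc k)
  have "q * rot q k w r + w (r + k) < q * rot q k w r + q"
    using assms by simp
  also have "\<dots> = q * Suc (rot q k w r)" by simp
  also have "\<dots> \<le> q * q ^ k" using Suc by (intro mult_le_mono2) simp
  finally show ?case by simp
qed simp

text \<open>The recursion splits off the last letter; splitting off the first one as well lets
  \<open>rot_orbit\<close> compare two consecutive windows.\<close>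

lemma rot_Suc_shift: "rot q (Suc k) w r = w r * q ^ k + rot q k w (Suc r)"
  by (induction k) (simp_all add: algebra_simps)

lemma rot_eq_0: "rot q k w r = 0 \<Longrightarrow> q > 0 \<Longrightarrow> i < k \<Longrightarrow> w (r + i) = 0"
  by (induction k) (auto simp: less_Suc_eq)

lemma rot_cong_on: "(\<And>i. i < k \<Longrightarrow> u (r + i) = v (r' + i)) \<Longrightarrow> rot q k u r = rot q k v r'"
  by (induction k) auto

text \<open>The first difference, at offset \<open>l\<close>, is a deficit of at least one. Every
  further letter multiplies it by \<open>q\<close>, which a letter of \<open>u\<close> below
  \<open>q\<close> cannot make up.\<close>

lemma rot_less_lex:
  assumes "\<And>i. i < l \<Longrightarrow> u (r + i) = v (r' + i)" and "u (r + l) < v (r' + l)"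
    and "\<And>i. u i < q" and "l < k"
  shows "rot q k u r < rot q k v r'"
  using \<open>l < k\<close>
proof (induction k)
  case (Suc k)
  show ?case
  proof (cases "l = k")
    case True
    then have "rot q k u r = rot q k v r'" using assms(1) by (intro rot_cong_on) auto
    then show ?thesis using assms(2) True by simp
  next
    case False
    then have "Suc (rot q k u r) \<le> rot q k v r'" using Suc by simp
    then have "q * Suc (rot q k u r) \<le> q * rot q k v r'" by (rule mult_le_mono2)
    then show ?thesis using assms(3)[of "r + k"] by simp
  qed
qed simp

lemma rot_eq_sum: "rot q k w r = (\<Sum>j<k. w (r + j) * q ^ (k - 1 - j))"
proof (induction k)
  case (Suc k)
  have "q * (\<Sum>j<k. w (r + j) * q ^ (k - 1 - j)) = (\<Sum>j<k. w (r + j) * q ^ (k - j))"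
    unfolding sum_distrib_left
  proof (rule sum.cong)
    fix j assume "j \<in> {..<k}"
    then have "q * q ^ (k - 1 - j) = q ^ (k - j)"
      by (simp flip: power_Suc add: Suc_diff_Suc)
    then show "q * (w (r + j) * q ^ (k - 1 - j)) = w (r + j) * q ^ (k - j)"
      by (metis mult.left_commute)
  qed simp
  then show ?case using Suc by simp
qed simp

lemma cong_1_mod_pred: "q > 0 \<Longrightarrow> [q = 1] (mod (q - 1))" for q :: nat
  by (simp add: cong_def mod_if le_mod_geq)

lemma rot_cong_digit_sum:
  assumes "q > 0"
  shows "[rot q k w r = (\<Sum>j<k. w (r + j))] (mod (q - 1))"
proof (induction k)
  case (Suc k)
  have "[q = 1] (mod (q - 1))"
    using assms by (rule cong_1_mod_pred)
  from cong_add[OF cong_mult[OF this Suc] cong_refl[of "w (r + k)"]]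
  show ?case by simp
qed simp

lemma digits_exist:
  assumes "z < q ^ m" and "q > 0"
  obtains w :: "nat \<Rightarrow> nat" where "\<And>i. w i < q" "\<And>i. w (i + m) = w i" "rot q m w 0 = z"
proof -
  define w where "w i = z div q ^ (m - 1 - i mod m) mod q" for i
  have "rot q k w 0 = z div q ^ (m - k)" if "k \<le> m" for k
    using that
  proof (induction k)
    case (Suc k)
    have e: "q ^ (m - k) = q ^ (m - Suc k) * q"
      using Suc.prems by (simp flip: power_Suc2 add: Suc_diff_Suc)
    have "w k = z div q ^ (m - Suc k) mod q" using Suc.prems by (simp add: w_def)
    then show ?case using Suc by (simp add: e div_mult2_eq)
  qed (use assms in simp)
  from this[of m] show thesis
    by (intro that[of w]) (use assms in \<open>auto simp: w_def\<close>)
qed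

section \<open>Cyclotomic cosets modulo a repunit and rotations of words\<close>

locale repunit =
  fixes q m n :: nat
  assumes q_ge_2: "q \<ge> 2" and m_pos: "m > 0" and repunit: "(q - 1) * n = q ^ m - 1"
begin

lemma n_pos: "n > 0"
proof (rule ccontr)
  assume "\<not> n > 0"
  then have "q ^ m \<le> 1" using repunit by simp
  moreover have "q ^ m > 1" using q_ge_2 m_pos by (intro one_less_power) auto
  ultimately show False by simp
qed

lemma power_cong_mod: "[q ^ (k + m) = q ^ k] (mod n)"
proof -
  have "q ^ m = 1 + (q - 1) * n" using repunit q_ge_2 by simp
  then have "[q ^ m = 1] (mod n)" by (simp only: cong_def mod_mult_self1)
  from cong_mult[OF cong_refl[of "q ^ k"] this] show ?thesis by (simp add: power_add)
qed

lemma power_cong_mod_period: "[q ^ (k mod m) = q ^ k] (mod n)"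
proof (induction k rule: less_induct)
  case (less k)
  show ?case
  proof (cases "k < m")
    case False
    then have "[q ^ ((k - m) mod m) = q ^ (k - m)] (mod n)" using m_pos by (intro less) auto
    also have "[q ^ (k - m) = q ^ k] (mod n)"
      using power_cong_mod[of "k - m"] False by (simp add: cong_sym)
    finally show ?thesis using False by (simp add: le_mod_geq)
  qed simp
qed

lemma cyclotomic_coset_eq_range: "cyclotomic_coset q m n t = range (\<lambda>j. t * q ^ j mod n)"
proof -
  have "t * q ^ j mod n = t * q ^ (j mod m) mod n" for j
    using power_cong_mod_period[of j] by (metis cong_def mod_mult_right_eq)
  then show ?thesis
    unfolding cyclotomic_coset_def using m_pos by (fastforce simp: image_iff intro: mod_less_divisor)
qed

lemma finite_cyclotomic_coset: "finite (cyclotomic_coset q m n t)"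
  unfolding cyclotomic_coset_def by simp

text \<open>A leader lies in the coset of which it is the minimum, hence its own orbit stays inside
  that coset. This gives a condition on \<open>x\<close> alone.\<close>

lemma coset_leaders_iff: "x \<in> coset_leaders q m n \<longleftrightarrow> x < n \<and> (\<forall>j. x \<le> x * q ^ j mod n)"
proof
  assume "x \<in> coset_leaders q m n"
  then obtain t where t: "x = Min (cyclotomic_coset q m n t)"
    by (auto simp: coset_leaders_def)
  have "x \<in> cyclotomic_coset q m n t"
    unfolding t by (intro Min_in finite_cyclotomic_coset) (auto simp: cyclotomic_coset_eq_range)
  then obtain i where i: "x = t * q ^ i mod n" by (auto simp: cyclotomic_coset_eq_range)
  have "x \<le> x * q ^ j mod n" for j
  proof -
    have "x * q ^ j mod n = t * q ^ (i + j) mod n"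
      unfolding i by (simp add: mod_mult_left_eq power_add mult.assoc)
    then have "x * q ^ j mod n \<in> cyclotomic_coset q m n t"
      by (auto simp: cyclotomic_coset_eq_range)
    then show ?thesis unfolding t by (intro Min_le finite_cyclotomic_coset)
  qed
  then show "x < n \<and> (\<forall>j. x \<le> x * q ^ j mod n)" using n_pos i by simp
next
  assume x: "x < n \<and> (\<forall>j. x \<le> x * q ^ j mod n)"
  then have "x = x * q ^ 0 mod n" by simp
  then have "x \<in> cyclotomic_coset q m n x" unfolding cyclotomic_coset_eq_range by blast
  then have "Min (cyclotomic_coset q m n x) = x"
    using x by (intro Min_eqI finite_cyclotomic_coset) (auto simp: cyclotomic_coset_eq_range)
  then show "x \<in> coset_leaders q m n"
    unfolding coset_leaders_def mem_Collect_eq using x by (intro exI[of _ x]) simp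
qed

text \<open>A coincidence for exponents \<open>i < j < m\<close>, multiplied by
  \<open>q ^ (m - j)\<close>, brings \<open>x\<close> back to itself after
  \<open>i + (m - j)\<close> steps, a number strictly between 0 and \<open>m\<close>.\<close>

lemma card_cyclotomic_coset:
  assumes "x < n" and "\<And>j. 0 < j \<Longrightarrow> j < m \<Longrightarrow> x * q ^ j mod n \<noteq> x"
  shows "card (cyclotomic_coset q m n x) = m"
proof -
  have "x * q ^ i mod n \<noteq> x * q ^ j mod n" if "i < j" "j < m" for i j
  proof
    assume eq: "x * q ^ i mod n = x * q ^ j mod n"
    have "x * q ^ (i + (m - j)) mod n = (x * q ^ i mod n) * q ^ (m - j) mod n"
      by (simp add: power_add mult.assoc mod_mult_left_eq)
    also have "\<dots> = x * (q ^ j * q ^ (m - j)) mod n"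
      by (simp add: eq mod_mult_left_eq mult.assoc)
    also have "q ^ j * q ^ (m - j) = q ^ (0 + m)" using that by (simp flip: power_add)
    also have "x * q ^ (0 + m) mod n = x * q ^ 0 mod n"
      using cong_mult[OF cong_refl power_cong_mod[of 0]] unfolding cong_def .
    finally have "x * q ^ (i + (m - j)) mod n = x" using assms(1) by simp
    then show False using assms(2)[of "i + (m - j)"] that by linarith
  qed
  then have "inj_on (\<lambda>j. x * q ^ j mod n) {..<m}"
    by (intro inj_onI) (metis lessThan_iff linorder_neqE_nat)
  then have "card ((\<lambda>j. x * q ^ j mod n) ` {..<m}) = m" by (simp add: card_image)
  moreover have "cyclotomic_coset q m n x = (\<lambda>j. x * q ^ j mod n) ` {..<m}"
    by (auto simp: cyclotomic_coset_def)
  ultimately show ?thesis by simp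
qed

text \<open>Moving the first letter of a window to its end replaces its value \<open>z\<close> by
  \<open>q * z - w r * (q ^ m - 1)\<close>. As \<open>q ^ m - 1 = (q - 1) * n\<close>, this is
  multiplication by \<open>q\<close> modulo \<open>n\<close> on the quotient by
  \<open>q - 1\<close>. Working with \<open>n - x\<close> turns large \<open>x\<close> into small
  words and excludes the zero word.\<close>

lemma rot_orbit:
  assumes w: "\<And>i. w i < q" "\<And>i. w (i + m) = w i"
    and x: "x < n" "rot q m w 0 = (q - 1) * (n - x)"
  shows "rot q m w r = (q - 1) * (n - x * q ^ r mod n)"
proof (induction r)
  case 0
  then show ?case using x by simp
next
  case (Suc r)
  define y where "y = x * q ^ r mod n"
  have y: "y < n" using n_pos by (simp add: y_def)
  have "rot q m w (Suc r) + w r * q ^ m = q * rot q m w r + w r"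
    using rot_Suc_shift[of q m w r] w(2)[of r] by simp
  moreover have "q ^ m = (q - 1) * n + 1" using repunit q_ge_2 by simp
  moreover have "rot q m w r = (q - 1) * (n - y)" using Suc by (simp only: y_def)
  ultimately have "rot q m w (Suc r) + w r * ((q - 1) * n + 1) = q * ((q - 1) * (n - y)) + w r"
    by metis
  moreover have "w r * ((q - 1) * n + 1) = (q - 1) * (w r * n) + w r"
    by (simp only: distrib_left mult_1_right mult.left_commute)
  moreover have "q * ((q - 1) * (n - y)) = (q - 1) * (q * (n - y))"
    by (rule mult.left_commute)
  ultimately have e: "rot q m w (Suc r) + (q - 1) * (w r * n) = (q - 1) * (q * (n - y))"
    by linarith
  then have "(q - 1) dvd rot q m w (Suc r)"
    by (metis dvd_add_left_iff dvd_triv_left)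
  then obtain v where v: "rot q m w (Suc r) = (q - 1) * v" ..
  with e have "(q - 1) * (v + w r * n) = (q - 1) * (q * (n - y))"
    by (simp add: algebra_simps)
  then have ev: "v + w r * n = q * (n - y)" using q_ge_2 by simp
  \<comment> \<open>For \<open>v = 0\<close> the number \<open>n - v\<close> would not be reduced
    modulo \<open>n\<close>. The zero window is impossible because its last letter is
    \<open>w r\<close>; if this vanishes, then \<open>v = q * (n - y) > 0\<close>.\<close>
  have "v > 0"
  proof (rule ccontr)
    assume "\<not> v > 0"
    then have "rot q m w (Suc r) = 0" using v by simp
    then have "w (Suc r + (m - 1)) = 0" using rot_eq_0[of q m w "Suc r" "m - 1"] q_ge_2 m_pos by simp
    then have "w r = 0" using w(2)[of r] m_pos by (simp add: add.commute)
    then show False using ev \<open>\<not> v > 0\<close> y q_ge_2 by simp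
  qed
  have "(q - 1) * v \<le> (q - 1) * n"
    using rot_less[of w q m "Suc r"] w(1) v repunit by simp
  then have "v \<le> n" using q_ge_2 by simp
  have "q * y + q * (n - y) = q * n" using y by (simp flip: distrib_left)
  then have "q * y + v + w r * n = q * n" using ev by simp
  \<comment> \<open>The quotient of \<open>q * y\<close> by \<open>n\<close> is the complementary
    digit \<open>q - 1 - w r\<close>, and the remainder is \<open>n - v\<close>.\<close>
  moreover have "q * n = (q - 1 - w r) * n + n + w r * n"
  proof -
    define d where "d = q - 1 - w r"
    then have "q = d + 1 + w r" using w(1)[of r] by linarith
    then show ?thesis unfolding d_def[symmetric] by (simp add: algebra_simps)
  qed
  ultimately have "q * y = (q - 1 - w r) * n + (n - v)" using \<open>v \<le> n\<close> by linarith
  moreover have "x * q ^ Suc r mod n = q * y mod n"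
    by (simp add: y_def mod_mult_right_eq mult_ac)
  ultimately have "x * q ^ Suc r mod n = n - v"
    using \<open>v > 0\<close> n_pos by (simp add: mod_mult_self3)
  then show ?case using v \<open>v \<le> n\<close> by simp
qed

end

section \<open>Positions of ones\<close>

definition marks :: "(nat \<Rightarrow> nat) \<Rightarrow> nat \<Rightarrow> nat" where
  "marks s i = of_bool (i \<in> range s)"

lemma marks_le_1: "marks s i \<le> 1"
  by (simp add: marks_def)

lemma marks_less: "q \<ge> 2 \<Longrightarrow> marks s i < q"
  using marks_le_1[of s i] by linarith

lemma marks_shift_iff:
  assumes "strict_mono s"
  shows "marks s (s i + p) = 1 \<longleftrightarrow> (\<exists>t. s (i + t) = s i + p)"
proof -
  have "\<exists>t. s (i + t) = s i + p" if "s i + p = s j" for j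
  proof -
    have "i \<le> j" using strict_mono_less_eq[OF assms] that by (metis le_add1)
    then show ?thesis using that by (intro exI[of _ "j - i"]) simp
  qed
  then show ?thesis by (auto simp: marks_def) (metis rangeI)
qed

lemma marks_agree_below:
  assumes "strict_mono s" "strict_mono s'" "\<And>t. t < l \<Longrightarrow> s (i + t) - s i = s' (j + t) - s' j"
    and "s i + p < s (i + l)" "s' j + p < s' (j + l)"
  shows "marks s (s i + p) = marks s' (s' j + p)"
proof -
  have "marks s (s i + p) = 1 \<longleftrightarrow> (\<exists>t<l. s (i + t) - s i = p)"
    unfolding marks_shift_iff[OF assms(1)] using assms(4) strict_mono_less[OF assms(1)]
      strict_mono_less_eq[OF assms(1)]
    by (metis add_diff_cancel_left' add_less_cancel_left le_add1 le_add_diff_inverse)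
  moreover have "marks s' (s' j + p) = 1 \<longleftrightarrow> (\<exists>t<l. s' (j + t) - s' j = p)"
    unfolding marks_shift_iff[OF assms(2)] using assms(5) strict_mono_less[OF assms(2)]
      strict_mono_less_eq[OF assms(2)]
    by (metis add_diff_cancel_left' add_less_cancel_left le_add1 le_add_diff_inverse)
  ultimately have "marks s (s i + p) = 1 \<longleftrightarrow> marks s' (s' j + p) = 1"
    using assms(3) by auto
  then show ?thesis by (auto simp: marks_def split: if_splits)
qed

text \<open>The words agree before the distance of the \<open>l\<close>-th one of \<open>s'\<close>.
  There \<open>s'\<close> has a one, while the next one of \<open>s\<close> comes later. So late
  ones mean small words, as long as this place lies within the window of length
  \<open>m\<close>.\<close>

lemma rot_marks_less:
  assumes s: "strict_mono s" "strict_mono s'" and q: "q \<ge> 2"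
    and eq: "\<And>t. t < l \<Longrightarrow> s (i + t) - s i = s' (j + t) - s' j"
    and gt: "s' (j + l) - s' j < s (i + l) - s i" and m: "s' (j + l) - s' j < m"
  shows "rot q m (marks s) (s i) < rot q m (marks s') (s' j)"
proof (rule rot_less_lex)
  let ?p = "s' (j + l) - s' j"
  have j: "s' j \<le> s' (j + l)" using s(2) by (simp add: strict_mono_less_eq)
  show "marks s (s i + p) = marks s' (s' j + p)" if "p < ?p" for p
    using that gt j by (intro marks_agree_below[OF s eq]) auto
  have "marks s' (s' j + ?p) = 1" using j by (simp add: marks_def)
  moreover have "marks s (s i + ?p) \<noteq> 1"
  proof
    assume "marks s (s i + ?p) = 1"
    then obtain t where t: "s (i + t) = s i + ?p" using marks_shift_iff[OF s(1)] by blast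
    then have "s (i + t) < s (i + l)" using gt by linarith
    then have "t < l" using strict_mono_less[OF s(1)] by simp
    with eq[OF this] t have "s' (j + t) - s' j = ?p" by simp
    moreover have "s' j \<le> s' (j + t)" using s(2) by (simp add: strict_mono_less_eq)
    ultimately have "s' (j + t) = s' (j + l)" using j by simp
    then show False using \<open>t < l\<close> s(2) by (simp add: strict_mono_eq)
  qed
  ultimately show "marks s (s i + ?p) < marks s' (s' j + ?p)"
    using marks_le_1[of s "s i + ?p"] by linarith
  show "marks s r < q" for r using q by (rule marks_less)
qed (fact m)

text \<open>The form in which maximality of a word is used: inequalities between words become lower
  bounds for distances between ones.\<close>

corollary rot_marks_le_imp:
  assumes s: "strict_mono s" "strict_mono s'" and q: "q \<ge> 2"
    and le: "rot q m (marks s) (s i) \<le> rot q m (marks s') (s' j)"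
    and eq: "\<And>t. t < l \<Longrightarrow> s (i + t) - s i = s' (j + t) - s' j"
    and m: "s' (j + l) - s' j < m"
  shows "s' (j + l) - s' j \<le> s (i + l) - s i"
proof (rule ccontr)
  assume "\<not> ?thesis"
  then have "rot q m (marks s') (s' j) < rot q m (marks s) (s i)"
    using eq m by (intro rot_marks_less[OF s(2,1) q, where l = l]) auto
  with le show False by simp
qed

lemma positions_exist:
  fixes w :: "nat \<Rightarrow> nat"
  assumes w: "\<And>i. w i \<le> 1" "\<And>i. w (i + m) = w i" "w 0 = 1" and m: "m > 0"
  obtains s where "strict_mono s" "s 0 = 0" "w = marks s" "\<And>i. s (i + (\<Sum>j<m. w j)) = s i + m"
proof -
  define S where "S = {i. w i = 1}"
  have per: "w (k * m) = 1" for k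
  proof (induction k)
    case (Suc k)
    then show ?case using w(2)[of "k * m"] by (simp add: add.commute)
  qed (use w in simp)
  have inf: "infinite S"
    unfolding infinite_nat_iff_unbounded_le
  proof
    fix k
    have "k * m \<ge> k" using m by simp
    then show "\<exists>i\<ge>k. i \<in> S" using per[of k]
      by (intro exI[of _ "k * m"]) (simp add: S_def)
  qed
  define s where "s = enumerate S"
  have s: "strict_mono s" using inf by (simp add: s_def strict_mono_enumerate)
  have ran: "range s = S" using inf by (simp add: s_def range_enumerate)
  have wm: "w = marks s"
  proof
    fix i show "w i = marks s i" using w(1)[of i] by (auto simp: marks_def ran S_def)
  qed
  \<comment> \<open>\<open>C\<close> counts the ones before a position. It inverts \<open>s\<close>
    and grows by \<open>C m\<close> over a period, so shifting a position by \<open>m\<close> shifts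
    the index by \<open>C m\<close>.\<close>
  define C where "C x = (\<Sum>j<x. w j)" for x
  have "w i = of_bool (i \<in> S)" for i using wm by (simp add: marks_def ran)
  then have C: "C x = card (S \<inter> {..<x})" for x
    by (simp add: C_def sum.If_cases of_bool_def Int_commute)
  have Cs: "C (s i) = i" for i
  proof -
    have "S \<inter> {..<s i} = s ` {..<i}"
      using strict_mono_less[OF s] by (auto simp flip: ran)
    then show ?thesis
      using strict_mono_imp_inj_on[OF s] by (simp add: C card_image inj_on_def strict_mono_eq[OF s])
  qed
  have Cm: "C (x + m) = C x + C m" for x
  proof (induction x)
    case (Suc x)
    then show ?case using w(2)[of x] by (simp add: C_def)
  qed (simp add: C_def)
  have "s (i + C m) = s i + m" for i
  proof -
    have "s i \<in> S" using ran by blast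
    then have "s i + m \<in> S" using w(2)[of "s i"] by (simp add: S_def)
    then obtain j where j: "s i + m = s j" using ran by (metis rangeE)
    then show ?thesis using Cs[of i] Cs[of j] Cm[of "s i"] by simp
  qed
  moreover have "s 0 = 0"
    using w(3) by (simp add: s_def enumerate_0 S_def)
  ultimately show thesis using that s wm by (simp add: C_def)
qed

lemma marks_periodic:
  assumes s: "strict_mono s" and per: "\<And>i. s (i + N) = s i + m" and s0: "s 0 = 0"
  shows "marks s (p + m) = marks s p"
proof -
  have sN: "s N = m" using per[of 0] s0 by simp
  have "p + m \<in> range s \<longleftrightarrow> p \<in> range s"
  proof
    assume "p + m \<in> range s"
    then obtain j where j: "s j = p + m" by auto
    then have "s N \<le> s j" using sN by simp
    then have "N \<le> j" using s by (simp add: strict_mono_less_eq)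
    then have "s (j - N) = p" using per[of "j - N"] j by simp
    then show "p \<in> range s" by auto
  next
    assume "p \<in> range s"
    then obtain j where "p = s j" by auto
    then show "p + m \<in> range s" using per[of j] rangeI[of s "j + N"] by simp
  qed
  then show ?thesis by (simp add: marks_def)
qed

lemma rot_marks_eq_sum:
  assumes s: "strict_mono s" and per: "s (i + N) = s i + m"
  shows "rot q m (marks s) (s i) = (\<Sum>t<N. q ^ (m - 1 - (s (i + t) - s i)))"
proof -
  let ?f = "\<lambda>t. s (i + t) - s i"
  have le: "s i \<le> s (i + t)" for t using s by (simp add: strict_mono_less_eq)
  have img: "{p \<in> {..<m}. marks s (s i + p) = 1} = ?f ` {..<N}" (is "?P = _")
  proof (rule equalityI; rule subsetI)
    fix p assume "p \<in> ?P"
    then obtain t where t: "p < m" "s (i + t) = s i + p" using marks_shift_iff[OF s] by auto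
    then have "s (i + t) < s (i + N)" using per by simp
    then have "t < N" using strict_mono_less[OF s] by simp
    then show "p \<in> ?f ` {..<N}" using t by (intro image_eqI[of _ _ t]) auto
  next
    fix p assume "p \<in> ?f ` {..<N}"
    then obtain t where t: "t < N" "p = ?f t" by auto
    then have "s (i + t) < s (i + N)" using strict_mono_less[OF s] by simp
    then show "p \<in> ?P" using t per le[of t] by (auto simp: marks_def)
  qed
  have inj: "inj_on ?f {..<N}"
    using le strict_mono_eq[OF s] by (intro inj_onI) (metis add_left_cancel le_add_diff_inverse)
  have "rot q m (marks s) (s i) = (\<Sum>p<m. marks s (s i + p) * q ^ (m - 1 - p))"
    by (rule rot_eq_sum)
  also have "\<dots> = (\<Sum>p<m. if marks s (s i + p) = 1 then q ^ (m - 1 - p) else 0)"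
    by (intro sum.cong) (auto simp: marks_def)
  also have "\<dots> = (\<Sum>p\<in>?P. q ^ (m - 1 - p))"
    by (subst sum.inter_filter) auto
  also have "\<dots> = (\<Sum>t<N. q ^ (m - 1 - ?f t))"
    unfolding img by (subst sum.reindex[OF inj]) simp
  finally show ?thesis .
qed

section \<open>Leaders described by positions of ones\<close>

context repunit
begin

text \<open>The bound on the word makes its leading letter at most 1. Each letter leads some
  rotation, and no rotation is larger, so all letters are 0 or 1. The word is not zero and therefore
  starts with 1. \<open>N\<close> is its digit sum, which is congruent to its value modulo
  \<open>q - 1\<close>.\<close>

lemma leader_positions:
  assumes x: "x \<in> coset_leaders q m n" and small: "(q - 1) * (n - x) < 2 * q ^ (m - 1)"
  obtains s N where "strict_mono s" "s 0 = 0" "N > 0" "(q - 1) dvd N"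
    "\<And>i. s (i + N) = s i + m" "rot q m (marks s) 0 = (q - 1) * (n - x)"
    "\<And>r. rot q m (marks s) r \<le> rot q m (marks s) 0"
proof -
  have xn: "x < n" and le: "\<And>j. x \<le> x * q ^ j mod n" using x by (auto simp: coset_leaders_iff)
  have "(q - 1) * (n - x) \<le> (q - 1) * n" by simp
  also have "\<dots> < q ^ m" using repunit q_ge_2 by simp
  finally obtain w :: "nat \<Rightarrow> nat" where
    w: "\<And>i. w i < q" "\<And>i. w (i + m) = w i" and z: "rot q m w 0 = (q - 1) * (n - x)"
    using digits_exist[of "(q - 1) * (n - x)" q m] q_ge_2 by (metis less_le_trans pos2)
  have orbit: "rot q m w r = (q - 1) * (n - x * q ^ r mod n)" for r
    using rot_orbit[OF w xn z] .
  have rle: "rot q m w r \<le> rot q m w 0" for r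
    unfolding orbit[of r] z using le by (intro mult_le_mono2 diff_le_mono2)
  have w1: "w i \<le> 1" for i
  proof -
    obtain k where k: "m = Suc k" using m_pos by (cases m) auto
    have "w i * q ^ k \<le> rot q m w i" unfolding k rot_Suc_shift by simp
    also have "\<dots> \<le> rot q m w 0" by (rule rle)
    also have "\<dots> < 2 * q ^ k" using small z k by simp
    finally show ?thesis using q_ge_2 by simp
  qed
  have w0: "w 0 = 1"
  proof (rule ccontr)
    assume "w 0 \<noteq> 1"
    then have "w 0 = 0" using w1[of 0] by simp
    have "w i = 0" for i
    proof (rule ccontr)
      assume "w i \<noteq> 0"
      then have "rot q m w 0 < rot q m w i"
        using \<open>w 0 = 0\<close> m_pos by (intro rot_less_lex[where l = 0]) (auto intro: w)
      then show False using rle[of i] by simp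
    qed
    then have "rot q m w 0 = 0" by (simp add: rot_eq_sum)
    then show False using z xn q_ge_2 by simp
  qed
  obtain s where s: "strict_mono s" "s 0 = 0" "w = marks s" "\<And>i. s (i + (\<Sum>j<m. w j)) = s i + m"
    using positions_exist[of w m] w1 w(2) w0 m_pos by blast
  have pos: "(\<Sum>j<m. w j) > 0" using w0 m_pos sum_pos2[of "{..<m}" 0 w] by simp
  have dvd: "(q - 1) dvd (\<Sum>j<m. w j)"
  proof -
    have "[(\<Sum>j<m. w (0 + j)) = (q - 1) * (n - x)] (mod (q - 1))"
      using rot_cong_digit_sum[of q m w 0] q_ge_2 z by (simp add: cong_def)
    from cong_dvd_iff[OF this] show ?thesis by simp
  qed
  show thesis
    using z rle unfolding s(3) by (intro that[OF s(1,2) pos dvd s(4)])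
qed

definition leader_of :: "(nat \<Rightarrow> nat) \<Rightarrow> nat" where
  "leader_of s = n - rot q m (marks s) 0 div (q - 1)"

text \<open>With \<open>q - 1\<close> ones per period the word is a sum of \<open>q - 1\<close>
  powers of \<open>q\<close>, each congruent to 1 modulo \<open>q - 1\<close>, so the division in
  \<open>leader_of\<close> is exact.\<close>

lemma leader_of:
  assumes s: "strict_mono s" "s 0 = 0" "\<And>i. s (i + (q - 1)) = s i + m"
  shows "leader_of s < n"
    and "rot q m (marks s) r = (q - 1) * (n - leader_of s * q ^ r mod n)"
    and "rot q m (marks s) 0 = (q - 1) * (n - leader_of s)"
proof -
  let ?z = "rot q m (marks s) 0"
  have z: "?z = (\<Sum>t<q - 1. q ^ (m - 1 - s t))"
    using rot_marks_eq_sum[OF s(1) s(3)[of 0], of q] s(2) by simp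
  have "[q = 1] (mod (q - 1))"
    using q_ge_2 by (intro cong_1_mod_pred) simp
  then have "[?z = (\<Sum>t<q - 1. 1)] (mod (q - 1))"
    unfolding z by (intro cong_sum) (metis cong_pow power_one)
  then have dv: "(q - 1) dvd ?z" by (simp add: cong_dvd_iff)
  then have zz: "?z = (q - 1) * (?z div (q - 1))" by simp
  have "?z > 0" unfolding z using q_ge_2 by (intro sum_pos) (auto simp: lessThan_empty_iff)
  then have 1: "?z div (q - 1) > 0" using zz by (metis gr0I mult_0_right)
  have "?z < q ^ m" by (rule rot_less) (use q_ge_2 marks_less in blast)
  then have "(q - 1) * (?z div (q - 1)) \<le> (q - 1) * n" using zz repunit by linarith
  then have 2: "?z div (q - 1) \<le> n" using q_ge_2 by simp
  show lt: "leader_of s < n" unfolding leader_of_def using 1 2 by simp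
  show z2: "?z = (q - 1) * (n - leader_of s)" unfolding leader_of_def using 2 zz by simp
  show "rot q m (marks s) r = (q - 1) * (n - leader_of s * q ^ r mod n)"
    using marks_periodic[OF s(1,3,2)] q_ge_2 marks_less lt z2 by (intro rot_orbit) auto
qed

text \<open>Rotations starting with a zero are below the word itself, which starts with 1, so only
  the starting points \<open>s i\<close> are compared. The weak inequality serves the balanced
  sequence, which is fixed by a proper rotation if \<open>m\<close> and \<open>q - 1\<close> have a
  common divisor above 1.\<close>

lemma leader_of_coset_leader:
  assumes s: "strict_mono s" "s 0 = 0" "\<And>i. s (i + (q - 1)) = s i + m"
    and le: "\<And>i. rot q m (marks s) (s i) \<le> rot q m (marks s) 0"
  shows "leader_of s \<in> coset_leaders q m n"
proof -
  have "rot q m (marks s) r \<le> rot q m (marks s) 0" for r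
  proof (cases "r \<in> range s")
    case True
    then show ?thesis using le by auto
  next
    case False
    have "rot q m (marks s) r < rot q m (marks s) 0"
      by (rule rot_less_lex[where l = 0])
        (use False s(2) m_pos q_ge_2 marks_less in \<open>auto simp: marks_def intro: rev_image_eqI\<close>)
    then show ?thesis by simp
  qed
  then have "(q - 1) * (n - leader_of s * q ^ r mod n) \<le> (q - 1) * (n - leader_of s)" for r
    using leader_of(2,3)[OF s] by metis
  then have "n - leader_of s * q ^ r mod n \<le> n - leader_of s" for r
    using q_ge_2 by simp
  then have "leader_of s \<le> leader_of s * q ^ r mod n" for r
    using leader_of(1)[OF s] n_pos by (meson diff_le_mono2 le_diff_iff' less_imp_le mod_less_divisor)
  then show ?thesis using leader_of(1)[OF s] by (simp add: coset_leaders_iff)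
qed

text \<open>Strictness means that no proper rotation fixes the word, which gives the full coset size
  \<open>m\<close>.\<close>

lemma leader_of_primitive:
  assumes s: "strict_mono s" "s 0 = 0" "\<And>i. s (i + (q - 1)) = s i + m"
    and less: "\<And>i. 0 < i \<Longrightarrow> i < q - 1 \<Longrightarrow> rot q m (marks s) (s i) < rot q m (marks s) 0"
  shows "leader_of s \<in> coset_leaders q m n"
    and "card (cyclotomic_coset q m n (leader_of s)) = m"
proof -
  have sm: "s (q - 1) = m" using s(2) s(3)[of 0] by simp
  have rot_less: "rot q m (marks s) r < rot q m (marks s) 0" if r: "0 < r" "r < m" for r
  proof (cases "r \<in> range s")
    case True
    then obtain i where i: "r = s i" by auto
    then have "i < q - 1" "0 < i"
      using r s(2) sm strict_mono_less[OF s(1)] by (metis neq0_conv)+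
    then show ?thesis using less i by simp
  next
    case False
    show "rot q m (marks s) r < rot q m (marks s) 0"
      by (rule rot_less_lex[where l = 0])
        (use False s(2) m_pos q_ge_2 marks_less in \<open>auto simp: marks_def intro: rev_image_eqI\<close>)
  qed
  have lt: "leader_of s * q ^ r mod n > leader_of s" if "0 < r" "r < m" for r
  proof (rule ccontr)
    assume "\<not> ?thesis"
    then have "rot q m (marks s) 0 \<le> rot q m (marks s) r"
      unfolding leader_of(2)[OF s, of r] leader_of(3)[OF s]
      by (intro mult_le_mono2 diff_le_mono2) simp
    then show False using rot_less[OF that] by simp
  qed
  have "leader_of s \<le> leader_of s * q ^ j mod n" for j
  proof (cases "j mod m = 0")
    case True
    then show ?thesis
      using power_cong_mod_period[of j] leader_of(1)[OF s]
      by (metis cong_def mod_less mod_mult_right_eq mult_1_right order_refl power_0)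
  next
    case False
    then show ?thesis using lt[of "j mod m"] power_cong_mod_period[of j] m_pos
      by (metis cong_def less_imp_le mod_less_divisor mod_mult_right_eq neq0_conv)
  qed
  then show "leader_of s \<in> coset_leaders q m n"
    using leader_of(1)[OF s] by (simp add: coset_leaders_iff)
  show "card (cyclotomic_coset q m n (leader_of s)) = m"
  proof (rule card_cyclotomic_coset)
    show "leader_of s < n" by (rule leader_of(1)[OF s])
    show "leader_of s * q ^ j mod n \<noteq> leader_of s" if "0 < j" "j < m" for j
      using lt[OF that] by simp
  qed
qed

end

section \<open>Reduction of the second largest leader to position sequences\<close>

lemma second_largest_eqI:
  assumes "finite S" "x \<in> S" "y \<in> S" "y < x" and "\<And>z. z \<in> S \<Longrightarrow> y < z \<Longrightarrow> z = x"
  shows "second_largest S = y"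
proof -
  have le: "z \<le> y" if "z \<in> S" "z \<noteq> x" for z
    using assms(5)[of z] that by force
  have "z \<le> x" if "z \<in> S" for z
    using le[of z] that assms(4) by (cases "z = x") auto
  then have "Max S = x" using assms(1,2) by (intro Max_eqI)
  moreover have "Max (S - {x}) = y" by (rule Max_eqI) (use assms(1,3,4) le in auto)
  ultimately show ?thesis by (simp add: second_largest_def)
qed

context repunit
begin

text \<open>Here \<open>primitive\<close> puts the word of \<open>s2\<close> strictly above its
  proper rotations, and \<open>balanced\<close> puts it above the balanced word. The first
  comparison in \<open>unique\<close> expresses that the word of \<open>s\<close> is maximal among
  its rotations, the second that none of these exceeds the word of \<open>s2\<close>; only the two
  known words may satisfy both.\<close>

lemma delta2_eq:
  assumes q: "q \<ge> 3" and mq: "q - 1 \<le> m"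
    and s2: "strict_mono s2" "s2 0 = 0" "\<And>i. s2 (i + (q - 1)) = s2 i + m"
    and primitive: "\<And>i. 0 < i \<Longrightarrow> i < q - 1 \<Longrightarrow>
      \<exists>l. s2 l < m \<and> s2 l < s2 (i + l) - s2 i \<and> (\<forall>t<l. s2 (i + t) - s2 i = s2 t)"
    and balanced: "\<exists>l. s2 l < m \<and> s2 l < l * m div (q - 1) \<and> (\<forall>t<l. s2 t = t * m div (q - 1))"
    and unique: "\<And>s N. \<lbrakk>strict_mono s; s 0 = 0; N > 0; (q - 1) dvd N; \<And>i. s (i + N) = s i + m;
      \<And>i l. s l < m \<Longrightarrow> (\<And>t. t < l \<Longrightarrow> s (i + t) - s i = s t) \<Longrightarrow> s l \<le> s (i + l) - s i;
      \<And>i l. s2 l < m \<Longrightarrow> (\<And>t. t < l \<Longrightarrow> s (i + t) - s i = s2 t) \<Longrightarrow> s2 l \<le> s (i + l) - s i\<rbrakk>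
      \<Longrightarrow> N = q - 1 \<and> ((\<forall>t<q - 1. s t = t * m div (q - 1)) \<or> (\<forall>t<q - 1. s t = s2 t))"
  shows "(q - 1) * delta2 q m n + (\<Sum>t<q - 1. q ^ (m - 1 - s2 t)) = q ^ m - 1"
    and "card (cyclotomic_coset q m n (delta2 q m n)) = m"
proof -
  define s1 where "s1 i = i * m div (q - 1)" for i
  \<comment> \<open>Seen from any one, the \<open>t\<close>-th next one is at least as far away as
    seen from position 0. Comparing powers term by term, no rotation of the balanced word exceeds
    the word itself.\<close>
  have superadd: "s1 i + s1 t \<le> s1 (i + t)" for i t
    unfolding s1_def distrib_right by (subst div_add1_eq) simp
  have s1: "strict_mono s1" "s1 0 = 0" "\<And>i. s1 (i + (q - 1)) = s1 i + m"
  proof -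
    have "s1 i < s1 (Suc i)" for i
    proof -
      have "1 \<le> s1 1" using mq q by (simp add: s1_def div_greater_zero_iff Suc_le_eq)
      then show ?thesis using superadd[of i 1] by simp
    qed
    then show "strict_mono s1" by (simp add: strict_mono_Suc_iff)
    show "s1 0 = 0" by (simp add: s1_def)
    show "s1 (i + (q - 1)) = s1 i + m" for i
    proof -
      have "(i + (q - 1)) * m = i * m + m * (q - 1)" by (simp only: distrib_right mult.commute[of m])
      then show ?thesis using q unfolding s1_def by (simp only: div_mult_self1)
    qed
  qed
  have leader1: "leader_of s1 \<in> coset_leaders q m n"
  proof (rule leader_of_coset_leader[OF s1])
    fix i
    have "rot q m (marks s1) (s1 i) = (\<Sum>t<q - 1. q ^ (m - 1 - (s1 (i + t) - s1 i)))"
      by (rule rot_marks_eq_sum[OF s1(1,3)])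
    also have "\<dots> \<le> (\<Sum>t<q - 1. q ^ (m - 1 - (s1 (0 + t) - s1 0)))"
    proof (intro sum_mono power_increasing diff_le_mono2)
      show "s1 (0 + t) - s1 0 \<le> s1 (i + t) - s1 i" for t
        using superadd[of i t] s1(2) by simp
    qed (use q in simp)
    also have "\<dots> = rot q m (marks s1) (s1 0)"
      by (rule rot_marks_eq_sum[OF s1(1,3), symmetric])
    finally show "rot q m (marks s1) (s1 i) \<le> rot q m (marks s1) 0" using s1(2) by simp
  qed
  have less2: "rot q m (marks s2) (s2 i) < rot q m (marks s2) 0" if i: "0 < i" "i < q - 1" for i
  proof -
    obtain l where l: "s2 l < m" "s2 l < s2 (i + l) - s2 i" "\<forall>t<l. s2 (i + t) - s2 i = s2 t"
      using primitive[OF i] by blast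
    show ?thesis
      using rot_marks_less[OF s2(1) s2(1) q_ge_2, of l i 0 m] l s2(2) by simp
  qed
  have leader2: "leader_of s2 \<in> coset_leaders q m n"
    and card2: "card (cyclotomic_coset q m n (leader_of s2)) = m"
    using leader_of_primitive[OF s2] less2 by auto
  have z1: "rot q m (marks s1) 0 = (q - 1) * (n - leader_of s1)"
    and z2: "rot q m (marks s2) 0 = (q - 1) * (n - leader_of s2)"
    using leader_of(3)[OF s1] leader_of(3)[OF s2] by auto
  have "rot q m (marks s1) 0 < rot q m (marks s2) 0"
  proof -
    obtain l where l: "s2 l < m" "s2 l < s1 l" "\<forall>t<l. s2 t = s1 t"
      using balanced unfolding s1_def by blast
    show ?thesis
      using rot_marks_less[OF s1(1) s2(1) q_ge_2, of l 0 0 m] l s1(2) s2(2) by simp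
  qed
  then have "leader_of s2 < leader_of s1"
    unfolding z1 z2 mult_less_cancel1 by linarith
  \<comment> \<open>This makes \<open>leader_positions\<close> applicable: a leader above
    \<open>leader_of s2\<close> has a word no larger than that of \<open>s2\<close>.\<close>
  have small: "rot q m (marks s2) 0 < 2 * q ^ (m - 1)"
  proof -
    obtain k where k: "m = Suc k" using m_pos by (cases m) auto
    have "marks s2 0 * q ^ k \<le> 1 * q ^ k" by (intro mult_le_mono1 marks_le_1)
    moreover have "rot q k (marks s2) (Suc 0) < q ^ k"
      by (rule rot_less) (use q_ge_2 marks_less in blast)
    ultimately show ?thesis unfolding k rot_Suc_shift diff_Suc_1 by linarith
  qed
  have "x = leader_of s1" if x: "x \<in> coset_leaders q m n" "leader_of s2 < x" for x
  proof -
    have xn: "x < n" using x coset_leaders_iff by simp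
    have le: "(q - 1) * (n - x) \<le> rot q m (marks s2) 0"
      unfolding z2 using x(2) by (intro mult_le_mono2 diff_le_mono2) simp
    obtain s N where s: "strict_mono s" "s 0 = 0" "N > 0" "(q - 1) dvd N"
      "\<And>i. s (i + N) = s i + m" and z: "rot q m (marks s) 0 = (q - 1) * (n - x)"
      and rle: "\<And>r. rot q m (marks s) r \<le> rot q m (marks s) 0"
      using leader_positions[OF x(1) le_less_trans[OF le small]] by blast
    have "N = q - 1 \<and> ((\<forall>t<q - 1. s t = t * m div (q - 1)) \<or> (\<forall>t<q - 1. s t = s2 t))"
    proof (rule unique[OF s])
      show "s l \<le> s (i + l) - s i" if "s l < m" "\<And>t. t < l \<Longrightarrow> s (i + t) - s i = s t" for i l
        using rot_marks_le_imp[OF s(1) s(1) q_ge_2, of m i 0 l] rle[of "s i"] that s(2) by simp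
      show "s2 l \<le> s (i + l) - s i" if "s2 l < m" "\<And>t. t < l \<Longrightarrow> s (i + t) - s i = s2 t" for i l
        using rot_marks_le_imp[OF s(1) s2(1) q_ge_2, of m i 0 l] rle[of "s i"] le z that s2(2)
        by simp
    qed
    then have N: "N = q - 1" and "(\<forall>t<q - 1. s t = s1 t) \<or> (\<forall>t<q - 1. s t = s2 t)"
      by (auto simp: s1_def)
    moreover have "rot q m (marks s) 0 = (\<Sum>t<q - 1. q ^ (m - 1 - s t))"
      using rot_marks_eq_sum[OF s(1) s(5)[of 0], of q] s(2) N by simp
    moreover have "rot q m (marks s1) 0 = (\<Sum>t<q - 1. q ^ (m - 1 - s1 t))"
      using rot_marks_eq_sum[OF s1(1) s1(3)[of 0], of q] s1(2) by simp
    moreover have "rot q m (marks s2) 0 = (\<Sum>t<q - 1. q ^ (m - 1 - s2 t))"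
      using rot_marks_eq_sum[OF s2(1) s2(3)[of 0], of q] s2(2) by simp
    ultimately have "rot q m (marks s) 0 = rot q m (marks s1) 0 \<or>
        rot q m (marks s) 0 = rot q m (marks s2) 0"
      by (auto intro!: sum.cong)
    then have "n - x = n - leader_of s1 \<or> n - x = n - leader_of s2"
      unfolding z z1 z2 using q by simp
    then show ?thesis using xn x(2) leader_of(1)[OF s1] leader_of(1)[OF s2] by auto
  qed
  moreover have "finite (coset_leaders q m n)"
    by (rule finite_subset[of _ "{..<n}"]) (auto simp: coset_leaders_iff)
  ultimately have d: "delta2 q m n = leader_of s2"
    unfolding delta2_def using leader1 leader2 \<open>leader_of s2 < leader_of s1\<close>
    by (intro second_largest_eqI)
  have "(q - 1) * leader_of s2 + (q - 1) * (n - leader_of s2) = (q - 1) * n"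
    using leader_of(1)[OF s2] by (simp flip: distrib_left)
  then show "(q - 1) * delta2 q m n + (\<Sum>t<q - 1. q ^ (m - 1 - s2 t)) = q ^ m - 1"
    using z2 repunit rot_marks_eq_sum[OF s2(1) s2(3)[of 0], of q] s2(2) d by simp
  show "card (cyclotomic_coset q m n (delta2 q m n)) = m"
    using card2 d by simp
qed

end

section \<open>Step functions\<close>

text \<open>The deviation of positions from \<open>a * t\<close>. Of the gain \<open>c\<close> per
  period, one falls on each of \<open>j1\<close> and \<open>j2\<close> and the rest on the period
  end. A jump position \<open>k\<close> takes no effect inside a period, so \<open>j2 = k\<close>
  covers functions with a single interior jump.\<close>

definition jumps :: "nat \<Rightarrow> nat \<Rightarrow> nat \<Rightarrow> nat \<Rightarrow> nat \<Rightarrow> nat" where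
  "jumps c k j1 j2 t = c * (t div k) + of_bool (j1 \<le> t mod k) + of_bool (j2 \<le> t mod k)"

lemma jumps_add_period: "k > 0 \<Longrightarrow> jumps c k j1 j2 (t + k) = jumps c k j1 j2 t + c"
  by (simp add: jumps_def)

lemma jumps_below: "t < k \<Longrightarrow> jumps c k j1 j2 t = of_bool (j1 \<le> t) + of_bool (j2 \<le> t)"
  by (simp add: jumps_def)

lemma jumps_period: "k > 0 \<Longrightarrow> 0 < j1 \<Longrightarrow> 0 < j2 \<Longrightarrow> jumps c k j1 j2 k = c"
  by (simp add: jumps_def)

lemma jumps_le_Suc:
  assumes "j1 \<le> k" "j2 \<le> k" "0 < k" "of_bool (j1 < k) + of_bool (j2 < k) \<le> c"
  shows "jumps c k j1 j2 t \<le> jumps c k j1 j2 (Suc t)"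
proof (cases "Suc (t mod k) = k")
  case True
  then have "Suc t div k = Suc (t div k)" by (simp add: div_Suc mod_Suc)
  then show ?thesis using assms True
    by (auto simp: jumps_def mod_Suc of_bool_def split: if_splits)
next
  case False
  then have "Suc t div k = t div k" by (simp add: div_Suc mod_Suc)
  then show ?thesis using assms False by (auto simp: jumps_def mod_Suc of_bool_def)
qed

text \<open>The alternative \<open>j2 = 2 * j1\<close> occurs for \<open>q \<equiv> 2\<close> modulo 3.\<close>

lemma jumps_primitive:
  assumes j: "0 < j1" "j1 \<le> j2" "j2 \<le> k" and c: "2 \<le> c" "j2 < k \<Longrightarrow> 3 \<le> c"
    and gaps: "k - j2 < j1" "j2 - j1 < j1 \<or> (j2 = 2 * j1 \<and> k - j1 < j2 \<and> 3 \<le> c)"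
    and i: "0 < i" "i < k"
  defines "E \<equiv> jumps c k j1 j2"
  shows "\<exists>l<k. E l < E (i + l) - E i \<and> (\<forall>t<l. E (i + t) - E i = E t)"
proof -
  have Et: "E t = (if t = k then c else of_bool (j1 \<le> t) + of_bool (j2 \<le> t))" if "t \<le> k" for t
    using that j i by (auto simp: E_def jumps_below jumps_period)
  \<comment> \<open>The distance from \<open>i\<close> to the next jump is compared with
    \<open>j1\<close>, the waiting time from 0. It is shorter except for \<open>i = j1\<close>,
    \<open>j2 = 2 * j1\<close>, where the first jumps tie and the second one, after
    \<open>k - j1\<close> instead of \<open>j2\<close> steps, decides. The witness \<open>l\<close>
    is the distance at which the shifted function gets ahead.\<close>
  consider "i < j1" | "j1 \<le> i" "i < j2" "j2 - i < j1" | "i = j1" "j2 = 2 * j1" "k - j1 < j2" "3 \<le> c"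
    | "j2 \<le> i"
    using gaps by linarith
  then show ?thesis
  proof cases
    case 1
    then show ?thesis using j c i
      by (intro exI[of _ "j1 - i"]) (auto simp: Et)
  next
    case 2
    then show ?thesis using j c i
      by (intro exI[of _ "j2 - i"]) (auto simp: Et)
  next
    case 3
    then show ?thesis using j c i
      by (intro exI[of _ "k - i"]) (auto simp: Et)
  next
    case 4
    then show ?thesis using j c i gaps(1)
      by (intro exI[of _ "k - i"]) (auto simp: Et)
  qed
qed

text \<open>By \<open>self\<close>, \<open>E\<close> is lexicographically least among its shifts, so
  no stretch of \<open>J1\<close> steps is free of jumps. Stretches starting at \<open>J1\<close>,
  at \<open>J2\<close> and just before the period end give the inequalities; \<open>bound\<close>
  keeps the jumps from coming later than those of the candidate.\<close>

lemma lex_minimal_jumps: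
  fixes E :: "nat \<Rightarrow> nat"
  assumes E: "mono E" "E 0 = 0" "\<And>t. E (t + k) = E t + c" and c: "c = 2 \<or> c = 3" and k: "k > 0"
    and self: "\<And>i l. l < k \<Longrightarrow> (\<And>t. t < l \<Longrightarrow> E (i + t) = E i + E t) \<Longrightarrow> E i + E l \<le> E (i + l)"
    and j: "0 < j1" "j1 \<le> j2" "j2 \<le> k"
    and bound: "\<And>l. l < k \<Longrightarrow> (\<And>t. t < l \<Longrightarrow> E t = jumps c k j1 j2 t) \<Longrightarrow> jumps c k j1 j2 l \<le> E l"
  obtains J1 J2 where "0 < J1" "J1 \<le> J2" "J2 \<le> k" "\<And>t. t < k \<Longrightarrow> E t = of_bool (J1 \<le> t) + of_bool (J2 \<le> t)"
    "J1 < j1 \<or> (J1 = j1 \<and> J2 \<le> j2)" "J2 \<le> 2 * J1" "c = 3 \<Longrightarrow> k \<le> J1 + J2"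
    "c = 2 \<Longrightarrow> J2 = k" "c = 3 \<Longrightarrow> k = J1 + J2 \<Longrightarrow> k + J1 \<le> 2 * J2"
proof -
  have Ek: "E k = c" using E(2) E(3)[of 0] by simp
  have mono: "E a \<le> E b" if "a \<le> b" for a b using E(1) that by (rule monoD)
  define J1 where "J1 = (LEAST t. 1 \<le> E t)"
  define J2 where "J2 = (LEAST t. 2 \<le> E t)"
  have geJ1: "1 \<le> E t \<longleftrightarrow> J1 \<le> t" for t
  proof
    show "1 \<le> E t \<Longrightarrow> J1 \<le> t" unfolding J1_def by (rule Least_le)
    have "1 \<le> E J1" unfolding J1_def by (rule LeastI[of _ k]) (use c Ek in auto)
    then show "J1 \<le> t \<Longrightarrow> 1 \<le> E t" using mono order_trans by blast
  qed
  have geJ2: "2 \<le> E t \<longleftrightarrow> J2 \<le> t" for t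
  proof
    show "2 \<le> E t \<Longrightarrow> J2 \<le> t" unfolding J2_def by (rule Least_le)
    have "2 \<le> E J2" unfolding J2_def by (rule LeastI[of _ k]) (use c Ek in auto)
    then show "J2 \<le> t \<Longrightarrow> 2 \<le> E t" using mono order_trans by blast
  qed
  have J1: "0 < J1" using geJ1[of 0] E(2) by (cases "J1 = 0") auto
  have J12: "J1 \<le> J2" using geJ1[of J2] geJ2[of J2] by auto
  have J2k: "J2 \<le> k" using geJ2[of k] Ek c by auto
  \<comment> \<open>Otherwise the function seen from \<open>i\<close> would stay constant for
    \<open>J1\<close> steps and be lexicographically below \<open>E\<close>.\<close>
  have step: "E i + 1 \<le> E (i + J1)" for i
  proof (cases "J1 < k")
    case True
    show ?thesis
    proof (rule ccontr)
      assume n: "\<not> ?thesis"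
      have "E (i + t) = E i + E t" if "t < J1" for t
        using mono[of i "i + t"] mono[of "i + t" "i + J1"] n that geJ1[of t] by simp
      from self[OF True this] show False using n geJ1[of J1] by linarith
    qed
  next
    case False
    then have "J1 = k" using J12 J2k by simp
    then show ?thesis using E(3)[of i] c by auto
  qed
  \<comment> \<open>The period end always carries a jump: \<open>J1\<close> steps from
    \<open>k - 1\<close> lead to index \<open>J1 - 1\<close> of the next period, before its first
    interior jump.\<close>
  have last: "E t \<le> c - 1" if "t < k" for t
  proof -
    have "E (k - 1) + 1 \<le> E (k - 1 + J1)" by (rule step)
    also have "k - 1 + J1 = (J1 - 1) + k" using J1 k by simp
    also have "E ((J1 - 1) + k) = E (J1 - 1) + c" by (rule E(3))
    also have "E (J1 - 1) = 0" using geJ1[of "J1 - 1"] J1 by linarith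
    finally show ?thesis using mono[of t "k - 1"] that by linarith
  qed
  have Et: "E t = of_bool (J1 \<le> t) + of_bool (J2 \<le> t)" if "t < k" for t
    using last[OF that] geJ1[of t] geJ2[of t] c by (auto simp: of_bool_def)
  have lex: "J1 < j1 \<or> (J1 = j1 \<and> J2 \<le> j2)"
  proof (rule ccontr)
    assume n: "\<not> ?thesis"
    show False
    proof (cases "J1 = j1")
      case True
      then have l: "j2 < J2" using n by simp
      have "E t = jumps c k j1 j2 t" if "t < j2" for t
        using that l True J2k j by (simp add: Et jumps_below)
      then have "jumps c k j1 j2 j2 \<le> E j2" using l J2k by (intro bound) auto
      then show False using l J2k j True by (simp add: Et jumps_below)
    next
      case False
      then have l: "j1 < J1" using n by simp
      have "E t = jumps c k j1 j2 t" if "t < j1" for t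
        using that l J12 J2k j by (simp add: Et jumps_below)
      then have "jumps c k j1 j2 j1 \<le> E j1" using l J12 J2k by (intro bound) auto
      then show False using l J12 J2k j by (simp add: Et jumps_below)
    qed
  qed
  have J2le: "J2 \<le> 2 * J1"
    using step[of J1] geJ1[of J1] geJ2[of "J1 + J1"] by (simp add: mult_2)
  have sum: "k \<le> J1 + J2" if "c = 3"
  proof (rule ccontr)
    assume "\<not> ?thesis"
    then have "E (J2 + J1) \<le> 2" using last[of "J2 + J1"] that by simp
    then show False using step[of J2] geJ2[of J2] by simp
  qed
  have c2: "J2 = k" if "c = 2"
    using last[of J2] geJ2[of J2] J2k that by (cases "J2 = k") auto
  \<comment> \<open>If \<open>k = J1 + J2\<close>, the function seen from \<open>J2\<close> also
    jumps first after \<open>J1\<close> steps, and next after \<open>2 * J1\<close>. Minimality of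
    \<open>E\<close> requires \<open>2 * J1 \<le> J2\<close>, which is the claim.\<close>
  have tie: "k + J1 \<le> 2 * J2" if c3: "c = 3" and k12: "k = J1 + J2"
  proof (rule ccontr)
    assume n: "\<not> ?thesis"
    have lt: "J2 < k" using k12 J1 by simp
    have EJ2: "E J2 = 2" using Et[OF lt] J12 by simp
    have "E (J2 + J2) \<le> 3"
    proof (rule ccontr)
      assume "\<not> ?thesis"
      moreover have "E (J2 + J2) = E (J2 - J1) + 3"
        using E(3)[of "J2 - J1"] k12 c3 J12 by (simp add: add.commute)
      ultimately show False using geJ1[of "J2 - J1"] n k12 by simp
    qed
    have "E (J2 + t) = E J2 + E t" if "t < J2" for t
    proof (cases "t < J1")
      case True
      then show ?thesis using Et[of t] Et[of "J2 + t"] lt k12 J12 EJ2 by simp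
    next
      case False
      have "3 \<le> E (J2 + t)" using mono[of k "J2 + t"] Ek c3 k12 False by simp
      moreover have "E (J2 + t) \<le> 3"
        using mono[of "J2 + t" "J2 + J2"] \<open>E (J2 + J2) \<le> 3\<close> that by simp
      ultimately show ?thesis using Et[of t] that lt False EJ2 by simp
    qed
    from self[OF lt this] show False using EJ2 \<open>E (J2 + J2) \<le> 3\<close> by simp
  qed
  show thesis by (rule that[OF J1 J12 J2k Et lex J2le sum c2 tie])
qed

lemma mult_period_div:
  fixes a c k t :: nat
  assumes "k > 0"
  shows "t * (a * k + c) div k = a * t + c * t div k"
proof -
  have "t * (a * k + c) = c * t + k * (a * t)" by (simp add: algebra_simps)
  then show ?thesis using assms by (simp only: div_mult_self2)
qed

context repunit
begin

text \<open>Reduces the cases of two and three jumps to arithmetic: by \<open>arith\<close>, every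
  pair allowed by \<open>lex_minimal_jumps\<close> other than the candidate yields the balanced
  sequence, whose deviation from \<open>a * t\<close> is \<open>c * t div k\<close>.\<close>

lemma delta2_jumps:
  fixes a c j1 j2 :: nat
  defines "k \<equiv> q - 1"
  defines "E2 \<equiv> jumps c k j1 j2"
  assumes k: "k \<ge> 3" and m: "m = a * k + c" and a: "a \<ge> 1" and c: "c = 2 \<or> c = 3"
    and j: "2 \<le> j1" "j1 \<le> j2" "j2 \<le> k" and c2: "j2 < k \<Longrightarrow> c = 3"
    and gaps: "k - j2 < j1" "j2 - j1 < j1 \<or> (j2 = 2 * j1 \<and> k - j1 < j2 \<and> c = 3)"
    and small: "k = 3 \<Longrightarrow> c = 3 \<Longrightarrow> j1 = 2 \<and> j2 = 2"
    and balanced: "l < k" "E2 l < c * l div k" "\<And>t. t < l \<Longrightarrow> E2 t = c * t div k"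
    and arith: "\<And>J1 J2 t. \<lbrakk>0 < J1; J1 \<le> J2; J2 \<le> k; J1 < j1 \<or> (J1 = j1 \<and> J2 \<le> j2);
      J2 \<le> 2 * J1; c = 3 \<Longrightarrow> k \<le> J1 + J2; c = 2 \<Longrightarrow> J2 = k;
      c = 3 \<Longrightarrow> k = J1 + J2 \<Longrightarrow> k + J1 \<le> 2 * J2\<rbrakk> \<Longrightarrow> \<not> (J1 = j1 \<and> J2 = j2) \<Longrightarrow> t < k \<Longrightarrow>
      of_bool (J1 \<le> t) + of_bool (J2 \<le> t) = c * t div k"
  shows "(q - 1) * delta2 q m n + (\<Sum>t<q - 1. q ^ (m - 1 - (a * t + E2 t))) = q ^ m - 1"
    and "card (cyclotomic_coset q m n (delta2 q m n)) = m"
proof -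
  define s2 where "s2 t = a * t + E2 t" for t
  have mono2: "mono E2"
    unfolding E2_def mono_iff_le_Suc by (intro allI jumps_le_Suc) (use j c k in \<open>auto simp: of_bool_def\<close>)
  have le2: "E2 i \<le> E2 (i + t)" for i t using monoD[OF mono2] by simp
  have s2: "strict_mono s2" "s2 0 = 0" "\<And>i. s2 (i + (q - 1)) = s2 i + m"
  proof -
    have "s2 i < s2 (Suc i)" for i using le2[of i 1] a by (simp add: s2_def)
    then show "strict_mono s2" by (simp add: strict_mono_Suc_iff)
    show "s2 0 = 0" using j k by (simp add: s2_def E2_def jumps_def)
    show "s2 (i + (q - 1)) = s2 i + m" for i
      using jumps_add_period[of k c j1 j2 i] k m
      unfolding s2_def E2_def k_def[symmetric] by (simp add: algebra_simps)
  qed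
  have s2k: "s2 k = m" using s2(3)[of 0] s2(2) by (simp add: k_def)
  have s2_less: "s2 t < m" if "t < k" for t
    using strict_mono_less[OF s2(1)] that s2k by metis
  have s2_diff: "s2 (i + t) - s2 i = a * t + (E2 (i + t) - E2 i)" for i t
    using le2[of i t] by (simp add: s2_def algebra_simps)
  have bal_div: "t * m div k = a * t + c * t div k" for t
    unfolding m using k by (intro mult_period_div) simp
  have q3: "3 \<le> q" using k by (simp add: k_def)
  have qm: "q - 1 \<le> m"
    using mult_le_mono1[OF a, of k] unfolding k_def[symmetric] m by linarith
  have bal: "\<exists>l. s2 l < m \<and> s2 l < l * m div (q - 1) \<and> (\<forall>t<l. s2 t = t * m div (q - 1))"
    using balanced s2_less unfolding k_def[symmetric] bal_div
    by (intro exI[of _ l]) (auto simp: s2_def)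
  have prim: "\<exists>l. s2 l < m \<and> s2 l < s2 (i + l) - s2 i \<and> (\<forall>t<l. s2 (i + t) - s2 i = s2 t)"
    if "0 < i" "i < q - 1" for i
  proof -
    have "\<exists>l<k. E2 l < E2 (i + l) - E2 i \<and> (\<forall>t<l. E2 (i + t) - E2 i = E2 t)"
      unfolding E2_def
    proof (rule jumps_primitive)
      show "0 < j1" "2 \<le> c" using j c by auto
      show "3 \<le> c" if "j2 < k" using c2 that by simp
      show "j2 - j1 < j1 \<or> (j2 = 2 * j1 \<and> k - j1 < j2 \<and> 3 \<le> c)" using gaps(2) by blast
      show "i < k" using that by (simp add: k_def)
    qed (fact that(1) j(2,3) gaps(1))+
    then show ?thesis using s2_less unfolding s2_diff by (auto simp: s2_def)
  qed
  have uniq: "N = q - 1 \<and> ((\<forall>t<q - 1. s t = t * m div (q - 1)) \<or> (\<forall>t<q - 1. s t = s2 t))"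
    if s: "strict_mono s" "s 0 = 0" "N > 0" "(q - 1) dvd N" "\<And>i. s (i + N) = s i + m"
      and self: "\<And>i l. s l < m \<Longrightarrow> (\<And>t. t < l \<Longrightarrow> s (i + t) - s i = s t) \<Longrightarrow> s l \<le> s (i + l) - s i"
      and bound: "\<And>i l. s2 l < m \<Longrightarrow> (\<And>t. t < l \<Longrightarrow> s (i + t) - s i = s2 t) \<Longrightarrow> s2 l \<le> s (i + l) - s i"
    for s N
  proof -
    \<comment> \<open>Since \<open>j1\<close> is at least 2, \<open>s2 1 = a\<close>, and the
      comparison at \<open>l = 1\<close> makes every distance at least \<open>a\<close>. Hence
      subtracting \<open>a * t\<close> leaves a monotone function.\<close>
    have gap: "s i + a \<le> s (Suc i)" for i
    proof -
      have "s2 1 \<le> s (i + 1) - s i"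
        by (rule bound) (use s2_less[of 1] k s2(2) in auto)
      moreover have "s2 1 = a" using j k by (simp add: s2_def E2_def jumps_below)
      ultimately show ?thesis using strict_monoD[OF s(1), of i "Suc i"] by simp
    qed
    have gaps_ge: "s i + a * t \<le> s (i + t)" for i t
    proof (induction t)
      case (Suc t)
      then show ?case using gap[of "i + t"] by simp
    qed simp
    obtain u where u: "N = k * u" using s(4) by (auto simp: k_def)
    have sN: "s N = m" using s(5)[of 0] s(2) by simp
    \<comment> \<open>At least \<open>2 * k\<close> ones at distances of at least \<open>a\<close>
      force \<open>a * k \<le> c\<close>, leaving only \<open>a = 1\<close>,
      \<open>k = c = 3\<close>, \<open>m = 6\<close> and the word of six ones. Its third one is at
      2, that of the candidate at 4.\<close>
    have "N = k"
    proof (rule ccontr)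
      assume "N \<noteq> k"
      then have "u \<noteq> 1" "u \<noteq> 0" using s(3) u by auto
      then have "2 \<le> u" by simp
      then have "k * 2 \<le> N" unfolding u by (rule mult_le_mono2)
      then have "a * (k * 2) \<le> a * N" by (rule mult_le_mono2)
      also have "\<dots> \<le> m" using gaps_ge[of 0 N] s(2) sN by simp
      finally have ak: "a * k \<le> c" by (simp add: m)
      have "a * 3 \<le> a * k" using k by (rule mult_le_mono2)
      then have "a = 1" using ak c a by linarith
      then have c3: "c = 3" "k = 3" using ak c k by auto
      then have m6: "m = 6" using m \<open>a = 1\<close> by simp
      have "6 \<le> N" using \<open>k * 2 \<le> N\<close> c3 by simp
      then have "s 6 \<le> 6" using sN m6 strict_mono_less_eq[OF s(1), of 6 N] by simp
      then have s1: "s 1 = 1" "s 2 = 2"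
        using gaps_ge[of 0 1] gaps_ge[of 1 5] gaps_ge[of 0 2] gaps_ge[of 2 4] s(2) \<open>a = 1\<close>
        by (auto simp flip: numeral_2_eq_2)
      have "s2 2 = 4" "s2 1 = 1"
        using small c3 \<open>a = 1\<close> by (auto simp: s2_def E2_def jumps_below)
      then have "s2 2 \<le> s (0 + 2) - s 0"
        by (intro bound) (use m6 s(2) s2(2) s1 in \<open>auto simp: less_Suc_eq numeral_2_eq_2\<close>)
      then show False using \<open>s2 2 = 4\<close> s1 s(2) by (simp flip: numeral_2_eq_2)
    qed
    define E where "E t = s t - a * t" for t
    have sE: "s t = a * t + E t" for t using gaps_ge[of 0 t] s(2) by (simp add: E_def)
    have monoE: "mono E"
      unfolding mono_iff_le_Suc
    proof
      show "E i \<le> E (Suc i)" for i using gap[of i] by (simp add: sE)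
    qed
    have "E 0 = 0" using s(2) sE[of 0] by simp
    have perE: "E (t + k) = E t + c" for t
      using s(5)[of t] \<open>N = k\<close> m by (simp add: sE distrib_left)
    have sk: "s t < m" if "t < k" for t
      using strict_mono_less[OF s(1), of t k] that sN \<open>N = k\<close> by simp
    have selfE: "E i + E l \<le> E (i + l)" if "l < k" "\<And>t. t < l \<Longrightarrow> E (i + t) = E i + E t" for i l
    proof -
      have "s l \<le> s (i + l) - s i"
        by (rule self) (use that sk in \<open>auto simp: sE distrib_left\<close>)
      then show ?thesis using monoD[OF monoE, of i "i + l"] by (simp add: sE distrib_left)
    qed
    have boundE: "jumps c k j1 j2 l \<le> E l" if "l < k" "\<And>t. t < l \<Longrightarrow> E t = jumps c k j1 j2 t" for l
    proof -
      have "s2 l \<le> s (0 + l) - s 0"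
        by (rule bound) (use that s2_less s(2) in \<open>auto simp: sE s2_def E2_def\<close>)
      then show ?thesis using s(2) by (simp add: sE s2_def E2_def)
    qed
    have "(\<forall>t<k. s t = t * m div k) \<or> (\<forall>t<k. s t = s2 t)"
    proof (rule lex_minimal_jumps[of E k c j1 j2])
      show "mono E" "E 0 = 0" "c = 2 \<or> c = 3" "j1 \<le> j2" "j2 \<le> k" by fact+
      show "E (t + k) = E t + c" for t by (rule perE)
      show "0 < k" "0 < j1" using k j by auto
      show "E i + E l \<le> E (i + l)" if "l < k" "\<And>t. t < l \<Longrightarrow> E (i + t) = E i + E t" for i l
        using that by (rule selfE)
      show "jumps c k j1 j2 l \<le> E l" if "l < k" "\<And>t. t < l \<Longrightarrow> E t = jumps c k j1 j2 t" for l
        using that by (rule boundE)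
    next
      fix J1 J2
      assume J: "0 < J1" "J1 \<le> J2" "J2 \<le> k" "J1 < j1 \<or> (J1 = j1 \<and> J2 \<le> j2)"
          "J2 \<le> 2 * J1" "c = 3 \<Longrightarrow> k \<le> J1 + J2" "c = 2 \<Longrightarrow> J2 = k"
          "c = 3 \<Longrightarrow> k = J1 + J2 \<Longrightarrow> k + J1 \<le> 2 * J2"
        and Et: "\<And>t. t < k \<Longrightarrow> E t = of_bool (J1 \<le> t) + of_bool (J2 \<le> t)"
      show ?thesis
      proof (cases "J1 = j1 \<and> J2 = j2")
        case True
        then show ?thesis using Et by (auto simp: sE s2_def E2_def jumps_below)
      next
        case False
        have "of_bool (J1 \<le> t) + of_bool (J2 \<le> t) = c * t div k" if "t < k" for t
          by (rule arith) (use J False that in blast)+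
        then show ?thesis using Et by (simp add: sE bal_div)
      qed
    qed
    then show ?thesis using \<open>N = k\<close> by (simp add: k_def)
  qed
  show "(q - 1) * delta2 q m n + (\<Sum>t<q - 1. q ^ (m - 1 - (a * t + E2 t))) = q ^ m - 1"
    unfolding s2_def[symmetric]
    by (rule delta2_eq(1)[OF q3 qm s2 _ bal]) (fact prim, fact uniq)
  show "card (cyclotomic_coset q m n (delta2 q m n)) = m"
    by (rule delta2_eq(2)[OF q3 qm s2 _ bal]) (fact prim, fact uniq)
qed

end

section \<open>The case of a single jump\<close>

text \<open>With a surplus of only 1 per period, distances of at least \<open>a\<close> leave just
  the balanced sequence. So one distance drops to \<open>a - 1\<close>; the next one,
  \<open>a + 2\<close>, makes up for it and takes the surplus as well.\<close>

definition dip :: "nat \<Rightarrow> nat \<Rightarrow> nat \<Rightarrow> nat" where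
  "dip a k t = (t div k) * (a * k + 1) +
     (if t mod k = 0 then 0 else if t mod k = 1 then a - 1 else a * (t mod k) + 1)"

lemma dip_below: "t < k \<Longrightarrow> dip a k t = (if t = 0 then 0 else if t = 1 then a - 1 else a * t + 1)"
  by (simp add: dip_def)

lemma dip_add_period: "k > 0 \<Longrightarrow> dip a k (t + k) = dip a k t + (a * k + 1)"
  by (simp add: dip_def)

lemma dip_gap:
  assumes "k \<ge> 3" "a \<ge> 1" "i < k"
  shows "dip a k (Suc i) = dip a k i + (if i = 0 then a - 1 else if i = 1 then a + 2 else a)"
proof (cases "Suc i = k")
  case True
  have "dip a k k = a * k + 1" using assms by (simp add: dip_def)
  moreover have "a * k = a * i + a" using True by (simp flip: True)
  moreover have "dip a k i = a * i + 1" using assms True by (simp add: dip_below)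
  moreover have "i \<noteq> 0" "i \<noteq> 1" using assms True by auto
  ultimately show ?thesis using True by simp
next
  case False
  then show ?thesis using assms by (auto simp: dip_below)
qed

lemma strict_mono_dip:
  assumes "k \<ge> 3" "a \<ge> 2"
  shows "strict_mono (dip a k)"
  unfolding strict_mono_Suc_iff
proof
  fix t
  have per: "dip a k (r + u * k) = dip a k r + u * (a * k + 1)" for r u
  proof (induction u)
    case (Suc u)
    have "r + Suc u * k = (r + u * k) + k" by simp
    then have "dip a k (r + Suc u * k) = dip a k (r + u * k) + (a * k + 1)"
      using dip_add_period[of k a "r + u * k"] assms by (simp only:)
    then show ?case using Suc by simp
  qed simp
  have "dip a k (t mod k) < dip a k (Suc (t mod k))"
    using assms dip_gap[of k a "t mod k"] by auto
  then show "dip a k t < dip a k (Suc t)"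
    using per[of "t mod k" "t div k"] per[of "Suc (t mod k)" "t div k"] by simp
qed

context repunit
begin

text \<open>Comparison with \<open>dip\<close> at indices 1 and 2 makes all distances at least
  \<open>a - 1\<close>, and a distance below \<open>a\<close> together with its successor at least
  \<open>2 * a + 1\<close>. The first distance then decides between the balanced sequence and
  \<open>dip\<close>.\<close>

lemma delta2_dip:
  fixes a :: nat
  defines "k \<equiv> q - 1"
  assumes k: "k \<ge> 3" and m: "m = a * k + 1" and a: "a \<ge> 3"
  shows "(q - 1) * delta2 q m n + (\<Sum>t<q - 1. q ^ (m - 1 - dip a k t)) = q ^ m - 1"
    and "card (cyclotomic_coset q m n (delta2 q m n)) = m"
proof -
  let ?s2 = "dip a k"
  have s2: "strict_mono ?s2" "?s2 0 = 0" "\<And>i. ?s2 (i + (q - 1)) = ?s2 i + m"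
  proof -
    show "strict_mono ?s2" using k a by (intro strict_mono_dip) auto
    show "?s2 0 = 0" by (simp add: dip_def)
    show "?s2 (i + (q - 1)) = ?s2 i + m" for i
      unfolding k_def[symmetric] m using k by (intro dip_add_period) simp
  qed
  have q3: "3 \<le> q" using k by (simp add: k_def)
  have qm: "q - 1 \<le> m"
    using mult_le_mono1[of 1 a k] a unfolding k_def[symmetric] m by linarith
  have s21: "?s2 1 = a - 1" and s22: "?s2 2 = 2 * a + 1"
    using k by (auto simp: dip_below)
  have "a * 3 \<le> a * k" using k by (rule mult_le_mono2)
  then have lt: "?s2 1 < m" "?s2 2 < m" using a unfolding m s21 s22 by linarith+
  have bal_div: "t * m div k = a * t + t div k" for t
    using mult_period_div[of k t a 1] k unfolding m by simp
  have bal: "\<exists>l. ?s2 l < m \<and> ?s2 l < l * m div (q - 1) \<and> (\<forall>t<l. ?s2 t = t * m div (q - 1))"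
    using lt s21 a s2(2) unfolding k_def[symmetric] bal_div by (intro exI[of _ 1]) auto
  have prim: "\<exists>l. ?s2 l < m \<and> ?s2 l < ?s2 (i + l) - ?s2 i \<and> (\<forall>t<l. ?s2 (i + t) - ?s2 i = ?s2 t)"
    if "0 < i" "i < q - 1" for i
    using lt s21 dip_gap[of k a i] that k a s2(2) by (intro exI[of _ 1]) (auto simp: k_def)
  have uniq: "N = q - 1 \<and> ((\<forall>t<q - 1. s t = t * m div (q - 1)) \<or> (\<forall>t<q - 1. s t = ?s2 t))"
    if s: "strict_mono s" "s 0 = 0" "N > 0" "(q - 1) dvd N" "\<And>i. s (i + N) = s i + m"
      and self: "\<And>i l. s l < m \<Longrightarrow> (\<And>t. t < l \<Longrightarrow> s (i + t) - s i = s t) \<Longrightarrow> s l \<le> s (i + l) - s i"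
      and bound: "\<And>i l. ?s2 l < m \<Longrightarrow> (\<And>t. t < l \<Longrightarrow> s (i + t) - s i = ?s2 t) \<Longrightarrow> ?s2 l \<le> s (i + l) - s i"
    for s N
  proof -
    have less: "s i < s (Suc i)" for i using strict_monoD[OF s(1)] by simp
    have gap: "s i + (a - 1) \<le> s (Suc i)" for i
    proof -
      have "?s2 1 \<le> s (i + 1) - s i"
        by (rule bound) (use lt s2(2) in auto)
      then show ?thesis using s21 less[of i] by simp
    qed
    have after_dip: "s i + (2 * a + 1) \<le> s (Suc (Suc i))" if "s (Suc i) < s i + a" for i
    proof -
      have "?s2 2 \<le> s (i + 2) - s i"
      proof (rule bound)
        fix t :: nat assume "t < 2"
        then have "t = 0 \<or> t = 1" by auto
        then show "s (i + t) - s i = ?s2 t" using gap[of i] that s21 s2(2) by auto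
      qed (fact lt(2))
      then show ?thesis using s22 less[of i] less[of "Suc i"] by simp
    qed
    have gaps_ge: "s i + (a - 1) * t \<le> s (i + t)" for i t
    proof (induction t)
      case (Suc t)
      then show ?case using gap[of "i + t"] by simp
    qed simp
    obtain u where u: "N = k * u" using s(4) by (auto simp: k_def)
    have sN: "s N = m" using s(5)[of 0] s(2) by simp
    \<comment> \<open>Here \<open>a \<ge> 3\<close> matters: \<open>2 * k\<close> distances of at
      least \<open>a - 1\<close> already exceed \<open>m = a * k + 1\<close>.\<close>
    have "N = k"
    proof (rule ccontr)
      assume "N \<noteq> k"
      then have "u \<noteq> 1" "u \<noteq> 0" using s(3) u by auto
      then have "2 \<le> u" by simp
      then have "k * 2 \<le> N" unfolding u by (rule mult_le_mono2)
      then have "(a - 1) * (k * 2) \<le> (a - 1) * N" by (rule mult_le_mono2)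
      also have "\<dots> \<le> m" using gaps_ge[of 0 N] s(2) sN by simp
      finally have le: "(a - 1) * (k * 2) \<le> a * k + 1" by (simp add: m)
      obtain a' where "a = a' + 3" using a by (metis le_add_diff_inverse2)
      then have "(a - 1) * (k * 2) = a * k + a' * k + k" by (simp add: algebra_simps)
      then show False using le k by simp
    qed
    have per: "s (i + k) = s i + m" for i using s(5) \<open>N = k\<close> by simp
    have sk: "s k = m" using sN \<open>N = k\<close> by simp
    have below: "s t < m" if "t < k" for t using strict_monoD[OF s(1) that] sk by simp
    have "(\<forall>t<k. s t = t * m div k) \<or> (\<forall>t<k. s t = ?s2 t)"
    proof (cases "a \<le> s 1")
      case True
      have gap_a: "s i + a \<le> s (Suc i)" for i
      proof -
        have "s 1 \<le> s (i + 1) - s i"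
          by (rule self) (use below[of 1] k s(2) in auto)
        then show ?thesis using True less[of i] by simp
      qed
      have ge: "s i + a * t \<le> s (i + t)" for i t
      proof (induction t)
        case (Suc t)
        then show ?case using gap_a[of "i + t"] by simp
      qed simp
      have "s t = a * t" if t: "t < k" for t
      proof (rule ccontr)
        assume "s t \<noteq> a * t"
        then have ex: "a * t + 1 \<le> s t" using ge[of 0 t] s(2) by simp
        define p where "p = (LEAST t. a * t + 1 \<le> s t)"
        have p: "a * p + 1 \<le> s p" "p \<le> t"
          unfolding p_def using ex by (auto intro: LeastI Least_le)
        have before: "s i = a * i" if "i < p" for i
          using not_less_Least[OF that[unfolded p_def]] ge[of 0 i] s(2) by simp
        obtain k' where k': "k = Suc k'" using k by (cases k) auto
        have "s p + a * (k' - p) \<le> s k'" using ge[of p "k' - p"] p t k' by simp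
        moreover have "a * p + a * (k' - p) = a * k'"
          using p t k' by (simp flip: distrib_left)
        ultimately have "a * k' + 1 \<le> s k'" using p by linarith
        moreover have "s k' + a \<le> a * k' + a + 1" using gap_a[of k'] sk k' m by simp
        ultimately have sk': "s k' = a * k' + 1" by linarith
        \<comment> \<open>Seen from the last one of the period, the first distance is
          \<open>a\<close> and the following ones repeat the beginning. The surplus then appears one
          index later than seen from 0, against \<open>self\<close>.\<close>
        have "s (k' + i) - s k' = a * i" if "i \<le> p" for i
        proof (cases i)
          case (Suc j)
          then have "s (k' + i) = s j + m" using per[of j] k' by (simp add: add.commute)
          then show ?thesis using before[of j] Suc that sk' m k' by simp
        qed simp
        then have "s p \<le> a * p"
          using self[of p k'] before below[of p] p(2) t by simp
        then show False using p by simp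
      qed
      then show ?thesis by (simp add: bal_div)
    next
      case False
      then have s1: "s 1 = a - 1" using gap[of 0] s(2) by simp
      \<comment> \<open>Backward induction: a distance below \<open>a\<close> is made up for two
        indices later by \<open>after_dip\<close>. It cannot be the last one of the period, because
        the distance after that is again \<open>a - 1\<close>.\<close>
      have upper: "s t \<le> a * t + 1" if "t \<le> k" for t
        using that
      proof (induction "k - t" arbitrary: t rule: less_induct)
        case less
        consider "t = k" | "Suc t = k" | "Suc (Suc t) \<le> k" using less.prems by linarith
        then show ?case
        proof cases
          case 1
          then show ?thesis using sk m by simp
        next
          case 2
          have "s (Suc k) = m + (a - 1)" using per[of 1] s1 by (simp add: add.commute)
          then have "s (Suc t) \<ge> s t + a"
            using after_dip[of t] 2 sk by (cases "s (Suc t) < s t + a") auto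
          then show ?thesis using 2 sk m by auto
        next
          case 3
          have "s (Suc t) \<le> a * Suc t + 1" by (rule less.hyps) (use 3 in auto)
          moreover have "s (Suc (Suc t)) \<le> a * Suc (Suc t) + 1"
            by (rule less.hyps) (use 3 in auto)
          ultimately show ?thesis
            using after_dip[of t] unfolding mult_Suc_right by linarith
        qed
      qed
      \<comment> \<open>From index 2 on the surplus over \<open>a * t\<close> is the maximum 1 that
        \<open>upper\<close> allows; a further distance below \<open>a\<close> would push it beyond
        this two indices later.\<close>
      have lower: "a * (t + 2) + 1 \<le> s (t + 2)" if "t + 2 < k" for t
        using that
      proof (induction t)
        case 0
        then show ?case using after_dip[of 0] False s(2) by (simp add: numeral_2_eq_2)
      next
        case (Suc t)
        have "\<not> s (Suc (t + 2)) < s (t + 2) + a"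
        proof
          assume "s (Suc (t + 2)) < s (t + 2) + a"
          from after_dip[OF this] show False
            using upper[of "Suc (Suc (t + 2))"] Suc by simp
        qed
        then show ?case using Suc by simp
      qed
      have "s t = a * t + 1" if t: "2 \<le> t" "t < k" for t
      proof -
        have "t - 2 + 2 = t" using t by simp
        then show ?thesis using t upper[of t] lower[of "t - 2"] by auto
      qed
      then have "s t = ?s2 t" if "t < k" for t
        using that s(2) s1 by (cases "t = 0 \<or> t = 1") (auto simp: dip_below)
      then show ?thesis by blast
    qed
    then show ?thesis using \<open>N = k\<close> by (simp add: k_def)
  qed
  show "(q - 1) * delta2 q m n + (\<Sum>t<q - 1. q ^ (m - 1 - ?s2 t)) = q ^ m - 1"
    by (rule delta2_eq(1)[OF q3 qm s2 _ bal]) (fact prim, fact uniq)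
  show "card (cyclotomic_coset q m n (delta2 q m n)) = m"
    by (rule delta2_eq(2)[OF q3 qm s2 _ bal]) (fact prim, fact uniq)
qed

end

section \<open>Closed forms\<close>

lemma double_div: "t < k \<Longrightarrow> 2 * t div k = of_bool (k \<le> 2 * t)" for t k :: nat
  by (auto simp: of_bool_def intro!: div_nat_eqI)

lemma triple_div: "t < k \<Longrightarrow> 3 * t div k = of_bool (k \<le> 3 * t) + of_bool (2 * k \<le> 3 * t)"
  for t k :: nat
  by (auto simp: of_bool_def intro!: div_nat_eqI)

text \<open>Dividing \<open>(k - t) * m\<close> by \<open>k\<close> with remainder turns
  \<open>m * t / k\<close> into \<open>m\<close> minus the quotient minus a fraction below 1. So the
  exponents in \<open>D\<close> are those of the balanced sequence in reverse order, and
  \<open>D\<close> is its leader.\<close>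

lemma ceiling_eq_div:
  fixes m k t :: nat
  assumes "1 \<le> t" "t \<le> k" "m > 0"
  shows "nat \<lceil>real m * real t / real k - 1\<rceil> = m - 1 - (k - t) * m div k"
proof -
  define d r where "d = (k - t) * m div k" and "r = (k - t) * m mod k"
  have k: "k > 0" using assms by simp
  have dr: "(k - t) * m = d * k + r" "r < k" using k by (simp_all add: d_def r_def)
  have "(k - t) * m < k * m" using assms by simp
  then have "d < m" unfolding d_def using k by (intro less_mult_imp_div_less) (simp add: mult.commute)
  have "(k - t) * m + t * m = k * m" using assms by (simp flip: distrib_right)
  then have "real d * real k + real r + real t * real m = real k * real m"
    unfolding dr by (metis of_nat_add of_nat_mult)
  then have "real m * real t / real k = real m - real d - real r / real k"
    using k by (simp add: field_simps)
  moreover have "0 \<le> real r / real k" "real r / real k < 1" using dr k by auto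
  ultimately have "\<lceil>real m * real t / real k - 1\<rceil> = int (m - 1 - d)"
    using \<open>d < m\<close> by (intro ceiling_unique) (auto simp: of_nat_diff)
  then show ?thesis by (simp add: d_def)
qed

lemma sum_diff_at:
  fixes f g :: "nat \<Rightarrow> real"
  assumes "p < k" "\<And>t. t < k \<Longrightarrow> t \<noteq> p \<Longrightarrow> f t = g t"
  shows "sum g {..<k} = sum f {..<k} + (g p - f p)"
proof -
  have "sum g {..<k} = g p + sum g ({..<k} - {p})" using assms by (simp add: sum.remove)
  also have "sum g ({..<k} - {p}) = sum f ({..<k} - {p})" using assms by (intro sum.cong) auto
  finally show ?thesis using assms(1) sum.remove[of "{..<k}" p f] by simp
qed

lemma sum_reverse_from_1: "(\<Sum>t<k. f t) = (\<Sum>t=1..k. f (k - t))" for k :: nat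
  by (rule sum.reindex_bij_witness[of _ "\<lambda>t. k - t" "\<lambda>t. k - t"]) auto

section \<open>Jump positions for b = 1 and b = 2\<close>

context repunit
begin

text \<open>With \<open>J2 = k\<close>, the bound \<open>J2 \<le> 2 * J1\<close> makes
  \<open>J1\<close> at least \<open>k / 2\<close> rounded up. That value is the balanced jump; one
  more is the runner-up.\<close>

lemma delta2_two:
  fixes a :: nat
  defines "k \<equiv> q - 1"
  assumes k: "k \<ge> 3" and m: "m = a * k + 2" and a: "a \<ge> 1"
  shows "(q - 1) * delta2 q m n +
      (\<Sum>t<q - 1. q ^ (m - 1 - (a * t + jumps 2 k ((k + 1) div 2 + 1) k t))) = q ^ m - 1"
    and "card (cyclotomic_coset q m n (delta2 q m n)) = m"
proof -
  let ?E = "jumps 2 k ((k + 1) div 2 + 1) k"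
  have c: "(2::nat) = 2 \<or> (2::nat) = 3" by simp
  have j: "2 \<le> (k + 1) div 2 + 1" "(k + 1) div 2 + 1 \<le> k" "k \<le> k" using k by linarith+
  have c2: "k < k \<Longrightarrow> (2::nat) = 3" by simp
  have gaps: "k - k < (k + 1) div 2 + 1"
    "k - ((k + 1) div 2 + 1) < (k + 1) div 2 + 1 \<or>
      (k = 2 * ((k + 1) div 2 + 1) \<and> k - ((k + 1) div 2 + 1) < k \<and> (2::nat) = 3)"
    by linarith+
  have small: "k = 3 \<Longrightarrow> (2::nat) = 3 \<Longrightarrow> (k + 1) div 2 + 1 = 2 \<and> k = 2" by simp
  have bal: "(k + 1) div 2 < k" using k by linarith
  have bal1: "?E ((k + 1) div 2) < 2 * ((k + 1) div 2) div k"
    unfolding double_div[OF bal] jumps_below[OF bal] using bal by auto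
  have bal2: "?E t = 2 * t div k" if "t < (k + 1) div 2" for t
  proof -
    have "t < k" using that bal by simp
    show ?thesis unfolding double_div[OF \<open>t < k\<close>] jumps_below[OF \<open>t < k\<close>] using that bal by auto
  qed
  have arith: "of_bool (J1 \<le> t) + of_bool (J2 \<le> t) = 2 * t div k"
    if "0 < J1" "J1 \<le> J2" "J2 \<le> k"
      "J1 < (k + 1) div 2 + 1 \<or> (J1 = (k + 1) div 2 + 1 \<and> J2 \<le> k)"
      "J2 \<le> 2 * J1" "(2::nat) = 3 \<Longrightarrow> k \<le> J1 + J2" "(2::nat) = 2 \<Longrightarrow> J2 = k"
      "(2::nat) = 3 \<Longrightarrow> k = J1 + J2 \<Longrightarrow> k + J1 \<le> 2 * J2"
      "\<not> (J1 = (k + 1) div 2 + 1 \<and> J2 = k)" "t < k" for J1 J2 t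
  proof -
    have "J2 = k" using that(7) by simp
    then have "J1 = (k + 1) div 2" using that(4,5,9) by linarith
    then have "J1 \<le> t \<longleftrightarrow> k \<le> 2 * t" by linarith
    then show ?thesis using \<open>J2 = k\<close> that(10) by (simp add: double_div)
  qed
  note main = delta2_jumps[OF k[unfolded k_def] m[unfolded k_def] a c j[unfolded k_def] _ gaps[unfolded k_def]
      _ bal[unfolded k_def] bal1[unfolded k_def]]
  show "(q - 1) * delta2 q m n + (\<Sum>t<q - 1. q ^ (m - 1 - (a * t + ?E t))) = q ^ m - 1"
    unfolding k_def
    by (rule main(1)) (fact c2[unfolded k_def] small[unfolded k_def] bal2[unfolded k_def] arith[unfolded k_def])+
  show "card (cyclotomic_coset q m n (delta2 q m n)) = m"
    by (rule main(2)) (fact c2[unfolded k_def] small[unfolded k_def] bal2[unfolded k_def] arith[unfolded k_def])+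
qed

text \<open>By \<open>J2 \<le> 2 * J1\<close> and \<open>k \<le> J1 + J2\<close>, the first jump is
  at least \<open>k / 3\<close>. The balanced pairs are \<open>A, 2 * A\<close>, then
  \<open>A + 1, 2 * A + 1\<close>, then \<open>A + 1, 2 * A + 2\<close> for remainders 0, 1, 2 of
  \<open>k\<close>. Equality \<open>k = J1 + J2\<close> survives the tie condition only for
  \<open>J2 = 2 * J1\<close>, so the candidate is the only other pair in range.\<close>

lemma delta2_three:
  fixes a j1 j2 A :: nat
  defines "k \<equiv> q - 1"
  assumes k: "k \<ge> 3" and m: "m = a * k + 3" and a: "a \<ge> 1"
    and j: "(k = 3 * A \<and> j1 = A + 1 \<and> j2 = 2 * A) \<or>
      (k = 3 * A + 1 \<and> j1 = A + 1 \<and> j2 = 2 * A + 2) \<or>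
      (k = 3 * A + 2 \<and> j1 = A + 2 \<and> j2 = 2 * A + 1)"
  shows "(q - 1) * delta2 q m n + (\<Sum>t<q - 1. q ^ (m - 1 - (a * t + jumps 3 k j1 j2 t))) = q ^ m - 1"
    and "card (cyclotomic_coset q m n (delta2 q m n)) = m"
proof -
  \<comment> \<open>The first index at which the candidate is below the balanced function.\<close>
  define l where "l = (if k = 3 * A then A else if k = 3 * A + 1 then 2 * A + 1 else A + 1)"
  have A: "A \<ge> 1" using k j by linarith
  have c: "(3::nat) = 2 \<or> (3::nat) = 3" by simp
  have jj: "2 \<le> j1" "j1 \<le> j2" "j2 \<le> k" using A j by linarith+
  have gaps: "k - j2 < j1" "j2 - j1 < j1 \<or> (j2 = 2 * j1 \<and> k - j1 < j2 \<and> (3::nat) = 3)"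
    using A j by linarith+
  have small: "k = 3 \<Longrightarrow> (3::nat) = 3 \<Longrightarrow> j1 = 2 \<and> j2 = 2" using j by presburger
  have bal: "l < k" using A j unfolding l_def by (auto split: if_splits)
  have bal1: "jumps 3 k j1 j2 l < 3 * l div k"
    unfolding triple_div[OF bal] jumps_below[OF bal] using j A by (auto simp: l_def)
  have bal2: "jumps 3 k j1 j2 t = 3 * t div k" if "t < l" for t
  proof -
    have "t < k" using that bal by simp
    show ?thesis unfolding triple_div[OF \<open>t < k\<close>] jumps_below[OF \<open>t < k\<close>] using that j A
      by (auto simp: l_def of_bool_def)
  qed
  have arith: "of_bool (J1 \<le> t) + of_bool (J2 \<le> t) = 3 * t div k"
    if "0 < J1" "J1 \<le> J2" "J2 \<le> k" "J1 < j1 \<or> (J1 = j1 \<and> J2 \<le> j2)"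
      "J2 \<le> 2 * J1" "(3::nat) = 3 \<Longrightarrow> k \<le> J1 + J2" "(3::nat) = 2 \<Longrightarrow> J2 = k"
      "(3::nat) = 3 \<Longrightarrow> k = J1 + J2 \<Longrightarrow> k + J1 \<le> 2 * J2"
      "\<not> (J1 = j1 \<and> J2 = j2)" "t < k" for J1 J2 t
  proof -
    have J: "k \<le> J1 + J2" "k \<noteq> J1 + J2 \<or> k + J1 \<le> 2 * J2" using that(6,8) by auto
    have "(k = 3 * A \<and> J1 = A \<and> J2 = 2 * A) \<or>
      (k = 3 * A + 1 \<and> J1 = A + 1 \<and> J2 = 2 * A + 1) \<or>
      (k = 3 * A + 2 \<and> J1 = A + 1 \<and> J2 = 2 * A + 2)"
      using j
    proof (elim disjE)
      assume *: "k = 3 * A \<and> j1 = A + 1 \<and> j2 = 2 * A"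
      then have "J1 = A" "J2 = 2 * A" using that(2-5,9) J by linarith+
      then show ?thesis using * by simp
    next
      assume *: "k = 3 * A + 1 \<and> j1 = A + 1 \<and> j2 = 2 * A + 2"
      then have "J1 = A + 1" "J2 = 2 * A + 1" using that(2-5,9) J by linarith+
      then show ?thesis using * by simp
    next
      assume *: "k = 3 * A + 2 \<and> j1 = A + 2 \<and> j2 = 2 * A + 1"
      then have "J1 = A + 1" "J2 = 2 * A + 2" using that(2-5,9) J by linarith+
      then show ?thesis using * by simp
    qed
    then have "(J1 \<le> t \<longleftrightarrow> k \<le> 3 * t) \<and> (J2 \<le> t \<longleftrightarrow> 2 * k \<le> 3 * t)" by linarith
    then show ?thesis using that(10) by (simp add: triple_div)
  qed
  have c2: "j2 < k \<Longrightarrow> (3::nat) = 3" by simp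
  note main = delta2_jumps[OF k[unfolded k_def] m[unfolded k_def] a c jj[unfolded k_def] _ gaps[unfolded k_def]
      _ bal[unfolded k_def] bal1[unfolded k_def]]
  show "(q - 1) * delta2 q m n + (\<Sum>t<q - 1. q ^ (m - 1 - (a * t + jumps 3 k j1 j2 t))) = q ^ m - 1"
    unfolding k_def
    by (rule main(1)) (fact c2[unfolded k_def] small[unfolded k_def] bal2[unfolded k_def] arith[unfolded k_def])+
  show "card (cyclotomic_coset q m n (delta2 q m n)) = m"
    by (rule main(2)) (fact c2[unfolded k_def] small[unfolded k_def] bal2[unfolded k_def] arith[unfolded k_def])+
qed

lemma real_eq_if_sum:
  fixes d :: nat
  assumes "(q - 1) * d + (\<Sum>t<k. q ^ f t) = q ^ m - 1"
  shows "real d = (real q ^ m - 1 - (\<Sum>t<k. real q ^ f t)) / (real q - 1)"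
proof -
  have "1 \<le> q ^ m" using q_ge_2 by simp
  then have "real ((q - 1) * d + (\<Sum>t<k. q ^ f t)) = real q ^ m - 1"
    unfolding assms by (simp add: of_nat_diff)
  then have "(real q - 1) * real d + (\<Sum>t<k. real q ^ f t) = real q ^ m - 1"
    using q_ge_2 by (simp add: of_nat_diff)
  then show ?thesis using q_ge_2 by (simp add: field_simps)
qed

end

section \<open>Evaluation of the exponent sums\<close>

lemma sum_dip:
  fixes x :: real
  assumes "k \<ge> 2" "a \<ge> 1" "m = a * k + 1"
  shows "(\<Sum>t<k. x ^ (m - 1 - dip a k t)) =
    x ^ (m - 1) + x ^ (m - a) + (\<Sum>l = 1..k - 2. x ^ (a * l - 1))"
proof -
  obtain h where h: "k = Suc (Suc h)" using assms(1) by (metis add_2_eq_Suc le_Suc_ex)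
  \<comment> \<open>The stated sum runs over \<open>l = k - t\<close>, for which the position
    \<open>a * t + 1\<close> gives the exponent \<open>a * l - 1\<close>. The indices 0 and 1 are
    treated apart and give \<open>x ^ (m - 1)\<close> and \<open>x ^ (m - a)\<close>.\<close>
  have "(\<Sum>t<h. x ^ (m - 1 - dip a k (Suc (Suc t)))) =
      (\<Sum>l = 1..h. x ^ (m - 1 - dip a k (Suc (Suc (h - l)))))"
    by (rule sum_reverse_from_1)
  also have "\<dots> = (\<Sum>l = 1..h. x ^ (a * l - 1))"
  proof (rule sum.cong)
    fix l assume l: "l \<in> {1..h}"
    then have "k = Suc (Suc (h - l)) + l" using h by simp
    then have "a * k = a * Suc (Suc (h - l)) + a * l" by (metis distrib_left)
    moreover have "dip a k (Suc (Suc (h - l))) = a * Suc (Suc (h - l)) + 1"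
      using l h by (subst dip_below) auto
    ultimately show "x ^ (m - 1 - dip a k (Suc (Suc (h - l)))) = x ^ (a * l - 1)"
      using assms(3) by simp
  qed simp
  finally have "(\<Sum>t<h. x ^ (m - 1 - dip a k (Suc (Suc t)))) = (\<Sum>l = 1..h. x ^ (a * l - 1))" .
  moreover have "dip a k 0 = 0" "dip a k 1 = a - 1" using h by (simp_all add: dip_below)
  moreover have "m - 1 - (a - 1) = m - a" using assms by simp
  moreover have "(\<Sum>t<k. x ^ (m - 1 - dip a k t)) = x ^ (m - 1 - dip a k 0) +
      (x ^ (m - 1 - dip a k 1) + (\<Sum>t<h. x ^ (m - 1 - dip a k (Suc (Suc t)))))"
    unfolding h sum.lessThan_Suc_shift by simp
  ultimately show ?thesis using h by simp
qed

lemma sum_jumps_two: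
  fixes x :: real
  assumes "k \<ge> 2" "m = a * k + 2"
  shows "(\<Sum>t<k. x ^ (m - 1 - (a * t + jumps 2 k ((k + 1) div 2 + 1) k t))) =
    x ^ (m - 1) + (\<Sum>l = 1..k div 2 - 1. x ^ (a * l)) + (\<Sum>l = k div 2..k - 1. x ^ (a * l + 1))"
proof -
  let ?f = "\<lambda>t. x ^ (m - 1 - (a * t + jumps 2 k ((k + 1) div 2 + 1) k t))"
  obtain h where h: "k = Suc h" using assms(1) by (cases k) auto
  have "(\<Sum>t<h. ?f (Suc t)) = (\<Sum>l = 1..h. ?f (Suc (h - l)))"
    by (rule sum_reverse_from_1)
  \<comment> \<open>In terms of \<open>l = k - t\<close> the jump has taken place exactly for
    \<open>l < k div 2\<close>, and it lowers the exponent \<open>a * l + 1\<close> by one.\<close>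
  also have "{1..h} = {1..k div 2 - 1} \<union> {k div 2..k - 1}" using assms(1) h by auto
  also have "(\<Sum>l\<in>\<dots>. ?f (Suc (h - l))) =
      (\<Sum>l = 1..k div 2 - 1. ?f (Suc (h - l))) + (\<Sum>l = k div 2..k - 1. ?f (Suc (h - l)))"
    by (rule sum.union_disjoint) auto
  also have "(\<Sum>l = 1..k div 2 - 1. ?f (Suc (h - l))) = (\<Sum>l = 1..k div 2 - 1. x ^ (a * l))"
  proof (rule sum.cong)
    fix l assume l: "l \<in> {1..k div 2 - 1}"
    then have t: "Suc (h - l) < k" "k = Suc (h - l) + l" "(k + 1) div 2 + 1 \<le> Suc (h - l)"
      using h by auto
    then have "a * k = a * Suc (h - l) + a * l" by (metis distrib_left)
    then show "?f (Suc (h - l)) = x ^ (a * l)" using t assms(2) by (simp add: jumps_below)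
  qed simp
  also have "(\<Sum>l = k div 2..k - 1. ?f (Suc (h - l))) = (\<Sum>l = k div 2..k - 1. x ^ (a * l + 1))"
  proof (rule sum.cong)
    fix l assume l: "l \<in> {k div 2..k - 1}"
    then have "0 < l" "l \<le> h" using assms(1) h by (auto simp: Suc_le_eq)
    then have t: "Suc (h - l) < k" "k = Suc (h - l) + l" "\<not> (k + 1) div 2 + 1 \<le> Suc (h - l)"
      using h l by auto
    then have "a * k = a * Suc (h - l) + a * l" by (metis distrib_left)
    then show "?f (Suc (h - l)) = x ^ (a * l + 1)" using t assms(2) by (simp add: jumps_below)
  qed simp
  finally have "(\<Sum>t<h. ?f (Suc t)) =
    (\<Sum>l = 1..k div 2 - 1. x ^ (a * l)) + (\<Sum>l = k div 2..k - 1. x ^ (a * l + 1))" .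
  moreover have "?f 0 = x ^ (m - 1)" using h by (simp add: jumps_below)
  moreover have "sum ?f {..<k} = ?f 0 + (\<Sum>t<h. ?f (Suc t))"
    unfolding h by (rule sum.lessThan_Suc_shift)
  ultimately show ?thesis by simp
qed

text \<open>Moving a jump by one index changes one exponent by one, and
  \<open>x ^ Suc e - x ^ e = (x - 1) * x ^ e\<close>. For \<open>x = q\<close> the factor cancels
  the denominator, which leaves the single powers next to \<open>D\<close>. If
  \<open>k = 3 * A + 2\<close>, both jumps move, in opposite directions.\<close>

lemma sum_jumps_three:
  fixes x :: real and a k m A :: nat
  assumes A: "A \<ge> 1" and m: "m = a * k + 3"
  defines "f \<equiv> \<lambda>t. x ^ (m - 1 - t * m div k)"
  defines "g \<equiv> \<lambda>j1 j2 t. x ^ (m - 1 - (a * t + jumps 3 k j1 j2 t))"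
  shows "k = 3 * A \<Longrightarrow> (\<Sum>t<k. g (A + 1) (2 * A) t) =
      (\<Sum>t<k. f t) + (x - 1) * x ^ (2 * A * a + 1)"
    and "k = 3 * A + 1 \<Longrightarrow> (\<Sum>t<k. g (A + 1) (2 * A + 2) t) =
      (\<Sum>t<k. f t) + (x - 1) * x ^ (A * a)"
    and "k = 3 * A + 2 \<Longrightarrow> (\<Sum>t<k. g (A + 2) (2 * A + 1) t) =
      (\<Sum>t<k. f t) + (x - 1) * x ^ ((2 * A + 1) * a + 1) - (x - 1) * x ^ ((A + 1) * a)"
proof -
  have f: "f t = x ^ (a * (k - t) + 2 - (of_bool (k \<le> 3 * t) + of_bool (2 * k \<le> 3 * t)))"
    if "t < k" for t
  proof -
    have "t * m div k = a * t + 3 * t div k" unfolding m using that by (intro mult_period_div) simp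
    moreover have "a * k = a * t + a * (k - t)" using that by (simp flip: distrib_left)
    ultimately have "m - 1 - t * m div k = a * (k - t) + 2 - 3 * t div k" by (simp add: m)
    then show ?thesis unfolding f_def using that by (simp add: triple_div)
  qed
  have g: "g j1 j2 t = x ^ (a * (k - t) + 2 - (of_bool (j1 \<le> t) + of_bool (j2 \<le> t)))"
    if "t < k" for t j1 j2
  proof -
    have "a * k = a * t + a * (k - t)" using that by (simp flip: distrib_left)
    then show ?thesis unfolding g_def using that by (simp add: jumps_below m)
  qed
  {
    assume k: "k = 3 * A"
    have eq: "f t = g (A + 1) (2 * A) t" if "t < k" "t \<noteq> A" for t
    proof -
      have "(k \<le> 3 * t) = (A + 1 \<le> t)" "(2 * k \<le> 3 * t) = (2 * A \<le> t)" using that k by auto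
      then show ?thesis using that by (simp only: f g)
    qed
    have "f A = x ^ (2 * A * a + 1)" "g (A + 1) (2 * A) A = x ^ Suc (2 * A * a + 1)"
      using A k by (simp_all add: f g mult_ac)
    with eq A k show "(\<Sum>t<k. g (A + 1) (2 * A) t) =
      (\<Sum>t<k. f t) + (x - 1) * x ^ (2 * A * a + 1)"
      by (subst sum_diff_at[of A k f]) (auto simp: algebra_simps)
  }
  {
    assume k: "k = 3 * A + 1"
    have eq: "f t = g (A + 1) (2 * A + 2) t" if "t < k" "t \<noteq> 2 * A + 1" for t
    proof -
      have "(k \<le> 3 * t) = (A + 1 \<le> t)" "(2 * k \<le> 3 * t) = (2 * A + 2 \<le> t)" using that k by auto
      then show ?thesis using that by (simp only: f g)
    qed
    have "f (2 * A + 1) = x ^ (A * a)" "g (A + 1) (2 * A + 2) (2 * A + 1) = x ^ Suc (A * a)"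
      using A k by (simp_all add: f g mult_ac)
    with eq A k show "(\<Sum>t<k. g (A + 1) (2 * A + 2) t) = (\<Sum>t<k. f t) + (x - 1) * x ^ (A * a)"
      by (subst sum_diff_at[of "2 * A + 1" k f]) (auto simp: algebra_simps)
  }
  {
    assume k: "k = 3 * A + 2"
    \<comment> \<open>Only the first jump is moved in \<open>h\<close>, so that each of the two
      comparisons concerns one index.\<close>
    define h where "h = f(A + 1 := g (A + 2) (2 * A + 1) (A + 1))"
    have eq: "h t = g (A + 2) (2 * A + 1) t" if "t < k" "t \<noteq> 2 * A + 1" for t
    proof (cases "t = A + 1")
      case False
      then have "(k \<le> 3 * t) = (A + 2 \<le> t)" "(2 * k \<le> 3 * t) = (2 * A + 1 \<le> t)"
        using that k by auto
      then show ?thesis using that False by (simp add: h_def f g)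
    qed (simp add: h_def)
    have "f (A + 1) = x ^ ((2 * A + 1) * a + 1)" "h (A + 1) = x ^ Suc ((2 * A + 1) * a + 1)"
      "h (2 * A + 1) = x ^ Suc ((A + 1) * a)" "g (A + 2) (2 * A + 1) (2 * A + 1) = x ^ ((A + 1) * a)"
      using A k by (simp_all add: f g h_def algebra_simps)
    moreover have "sum h {..<k} = sum f {..<k} + (h (A + 1) - f (A + 1))"
      by (rule sum_diff_at) (use k in \<open>auto simp: h_def\<close>)
    moreover have "(\<Sum>t<k. g (A + 2) (2 * A + 1) t) =
        sum h {..<k} + (g (A + 2) (2 * A + 1) (2 * A + 1) - h (2 * A + 1))"
      by (rule sum_diff_at) (use k eq in auto)
    ultimately show "(\<Sum>t<k. g (A + 2) (2 * A + 1) t) =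
      (\<Sum>t<k. f t) + (x - 1) * x ^ ((2 * A + 1) * a + 1) - (x - 1) * x ^ ((A + 1) * a)"
      by (simp add: algebra_simps)
  }
qed

section \<open>Assembly of the cases b = 0, 1, 2\<close>

theorem lemma31:
  fixes q m n a b :: nat
  assumes "primepow q" and "q > 3" and "m \<ge> q"
    and "n = (q ^ m - 1) div (q - 1)"
    and "m - 1 = a * (q - 1) + b" and "a \<ge> 1" and "b \<le> q - 2"
  shows
    "(a \<ge> 3 \<and> b = 0 \<longrightarrow>
        real (delta2 q m n) =
          (real q ^ m - 1 - real q ^ (m - 1) - real q ^ (m - a)
             - (\<Sum>l = 1..q - 3. real q ^ (a * l - 1))) / (real q - 1)
        \<and> card (cyclotomic_coset q m n (delta2 q m n)) = m)
   \<and> (b = 1 \<longrightarrow>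
        (let A = (q - 1) div 2 in
          real (delta2 q m n) =
            (real q ^ m - 1 - real q ^ (m - 1)
               - (\<Sum>l = 1..A - 1. real q ^ (a * l))
               - (\<Sum>l = A..q - 2. real q ^ (a * l + 1))) / (real q - 1))
        \<and> card (cyclotomic_coset q m n (delta2 q m n)) = m)
   \<and> (b = 2 \<longrightarrow>
        (let A = (q - 1) div 3;
             D = (real q ^ m - 1
                    - (\<Sum>t = 1..q - 1. real q ^ nat \<lceil>real m * real t / (real q - 1) - 1\<rceil>))
                  / (real q - 1)
         in ([q = 0] (mod 3) \<longrightarrow>
               real (delta2 q m n) = D - real q ^ ((2 * A + 1) * a + 1) + real q ^ ((A + 1) * a))
          \<and> ([q = 1] (mod 3) \<longrightarrow>
               real (delta2 q m n) = D - real q ^ (2 * A * a + 1))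
          \<and> ([q = 2] (mod 3) \<longrightarrow>
               real (delta2 q m n) = D - real q ^ (A * a)))
        \<and> card (cyclotomic_coset q m n (delta2 q m n)) = m)"
proof -
  define k where "k = q - 1"
  have k: "k \<ge> 3" using assms(2) by (simp add: k_def)
  have rk: "real q - 1 = real k" using assms(2) by (simp add: k_def of_nat_diff)
  have m: "m = a * k + b + 1" using assms(3,5) k unfolding k_def by linarith
  interpret repunit q m n
  proof
    show "q \<ge> 2" "m > 0" using assms(2,3) by auto
    \<comment> \<open>This makes the division that defines \<open>n\<close> exact.\<close>
    have "[q = 1] (mod (q - 1))" using assms(2) by (intro cong_1_mod_pred) simp
    from cong_pow[OF this, of m] have "[q ^ m = 1] (mod (q - 1))" by simp
    from cong_to_1_nat[OF this] show "(q - 1) * n = q ^ m - 1"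
      unfolding assms(4) by (rule dvd_mult_div_cancel)
  qed
  have goal1: "real (delta2 q m n) =
          (real q ^ m - 1 - real q ^ (m - 1) - real q ^ (m - a)
             - (\<Sum>l = 1..q - 3. real q ^ (a * l - 1))) / (real q - 1)
        \<and> card (cyclotomic_coset q m n (delta2 q m n)) = m" if "a \<ge> 3 \<and> b = 0"
  proof
    have m1: "m = a * k + 1" using m that by simp
    have "(q - 1) * delta2 q m n + (\<Sum>t<k. q ^ (m - 1 - dip a k t)) = q ^ m - 1"
      unfolding k_def using k m1 that by (intro delta2_dip(1)[of a]) (auto simp: k_def)
    then have "real (delta2 q m n) =
        (real q ^ m - 1 - (\<Sum>t<k. real q ^ (m - 1 - dip a k t))) / (real q - 1)"
      by (rule real_eq_if_sum)
    moreover have "q - 3 = k - 2" using k by (simp add: k_def)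
    ultimately show "real (delta2 q m n) = (real q ^ m - 1 - real q ^ (m - 1) - real q ^ (m - a)
             - (\<Sum>l = 1..q - 3. real q ^ (a * l - 1))) / (real q - 1)"
      using sum_dip[of k a m "real q"] k assms(6) m1 by simp
    show "card (cyclotomic_coset q m n (delta2 q m n)) = m"
      using k m1 that by (intro delta2_dip(2)[of a]) (auto simp: k_def)
  qed
  have goal2: "(let A = (q - 1) div 2 in
          real (delta2 q m n) =
            (real q ^ m - 1 - real q ^ (m - 1)
               - (\<Sum>l = 1..A - 1. real q ^ (a * l))
               - (\<Sum>l = A..q - 2. real q ^ (a * l + 1))) / (real q - 1))
        \<and> card (cyclotomic_coset q m n (delta2 q m n)) = m" if "b = 1"
  proof
    have m2: "m = a * k + 2" using m that by simp
    let ?E = "jumps 2 k ((k + 1) div 2 + 1) k"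
    have "(q - 1) * delta2 q m n + (\<Sum>t<k. q ^ (m - 1 - (a * t + ?E t))) = q ^ m - 1"
      unfolding k_def using k m2 assms(6) by (intro delta2_two(1)[of a]) (auto simp: k_def)
    then have "real (delta2 q m n) =
        (real q ^ m - 1 - (\<Sum>t<k. real q ^ (m - 1 - (a * t + ?E t)))) / (real q - 1)"
      by (rule real_eq_if_sum)
    also have "\<dots> = (real q ^ m - 1 - real q ^ (m - 1)
               - (\<Sum>l = 1..k div 2 - 1. real q ^ (a * l))
               - (\<Sum>l = k div 2..k - 1. real q ^ (a * l + 1))) / (real q - 1)"
      using sum_jumps_two[of k m a "real q"] k m2 by simp
    finally show "let A = (q - 1) div 2 in real (delta2 q m n) =
            (real q ^ m - 1 - real q ^ (m - 1)
               - (\<Sum>l = 1..A - 1. real q ^ (a * l))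
               - (\<Sum>l = A..q - 2. real q ^ (a * l + 1))) / (real q - 1)"
      unfolding k_def Let_def by (simp add: numeral_2_eq_2)
    show "card (cyclotomic_coset q m n (delta2 q m n)) = m"
      using k m2 assms(6) by (intro delta2_two(2)[of a]) (auto simp: k_def)
  qed
  have goal3: "(let A = (q - 1) div 3;
             D = (real q ^ m - 1
                    - (\<Sum>t = 1..q - 1. real q ^ nat \<lceil>real m * real t / (real q - 1) - 1\<rceil>))
                  / (real q - 1)
         in ([q = 0] (mod 3) \<longrightarrow>
               real (delta2 q m n) = D - real q ^ ((2 * A + 1) * a + 1) + real q ^ ((A + 1) * a))
          \<and> ([q = 1] (mod 3) \<longrightarrow>
               real (delta2 q m n) = D - real q ^ (2 * A * a + 1))
          \<and> ([q = 2] (mod 3) \<longrightarrow>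
               real (delta2 q m n) = D - real q ^ (A * a)))
        \<and> card (cyclotomic_coset q m n (delta2 q m n)) = m" if "b = 2"
  proof -
    have m3: "m = a * k + 3" using m that by simp
    define A where "A = k div 3"
    have A: "A \<ge> 1" using k by (simp add: A_def)
    have q: "q = k + 1" using k by (simp add: k_def)
    define F where "F = (\<Sum>t<k. real q ^ (m - 1 - t * m div k))"
    define D where "D = (real q ^ m - 1 - F) / (real q - 1)"
    have "(\<Sum>t = 1..q - 1. real q ^ nat \<lceil>real m * real t / (real q - 1) - 1\<rceil>) =
        (\<Sum>t = 1..k. real q ^ (m - 1 - (k - t) * m div k))"
      unfolding rk k_def[symmetric]
      by (intro sum.cong refl, subst ceiling_eq_div) (use m_pos in auto)
    also have "\<dots> = F" unfolding F_def by (rule sum_reverse_from_1[symmetric])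
    finally have D: "(real q ^ m - 1
        - (\<Sum>t = 1..q - 1. real q ^ nat \<lceil>real m * real t / (real q - 1) - 1\<rceil>)) / (real q - 1) = D"
      by (simp add: D_def)
    have D_minus: "(real q ^ m - 1 - (F + (real q - 1) * y)) / (real q - 1) = D - y" for y
      using k by (simp add: D_def rk field_simps)
    have main: "real (delta2 q m n) =
          (real q ^ m - 1 - (\<Sum>t<k. real q ^ (m - 1 - (a * t + jumps 3 k j1 j2 t)))) / (real q - 1)"
        "card (cyclotomic_coset q m n (delta2 q m n)) = m"
      if j: "(k = 3 * A \<and> j1 = A + 1 \<and> j2 = 2 * A) \<or>
        (k = 3 * A + 1 \<and> j1 = A + 1 \<and> j2 = 2 * A + 2) \<or>
        (k = 3 * A + 2 \<and> j1 = A + 2 \<and> j2 = 2 * A + 1)" for j1 j2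
    proof -
      note delta = delta2_three[of a A j1 j2, folded k_def, OF k m3 assms(6) j]
      show "real (delta2 q m n) =
          (real q ^ m - 1 - (\<Sum>t<k. real q ^ (m - 1 - (a * t + jumps 3 k j1 j2 t)))) / (real q - 1)"
        by (rule real_eq_if_sum) (use delta(1) in \<open>simp only: k_def\<close>)
      show "card (cyclotomic_coset q m n (delta2 q m n)) = m" by (rule delta(2))
    qed
    have sums: "k = 3 * A \<Longrightarrow> real (delta2 q m n) = D - real q ^ (2 * A * a + 1)"
      "k = 3 * A + 1 \<Longrightarrow> real (delta2 q m n) = D - real q ^ (A * a)"
      "k = 3 * A + 2 \<Longrightarrow> real (delta2 q m n) = D - real q ^ ((2 * A + 1) * a + 1) + real q ^ ((A + 1) * a)"
    proof -
      show "real (delta2 q m n) = D - real q ^ (2 * A * a + 1)" if "k = 3 * A"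
        using main(1)[of "A + 1" "2 * A"] sum_jumps_three(1)[OF A m3 that, of "real q"] that
          D_minus[of "real q ^ (2 * A * a + 1)"] unfolding F_def by simp
      show "real (delta2 q m n) = D - real q ^ (A * a)" if "k = 3 * A + 1"
        using main(1)[of "A + 1" "2 * A + 2"] sum_jumps_three(2)[OF A m3 that, of "real q"] that
          D_minus[of "real q ^ (A * a)"] unfolding F_def by simp
      show "real (delta2 q m n) = D - real q ^ ((2 * A + 1) * a + 1) + real q ^ ((A + 1) * a)"
        if "k = 3 * A + 2"
      proof -
        let ?y = "real q ^ ((2 * A + 1) * a + 1) - real q ^ ((A + 1) * a)"
        have "(\<Sum>t<k. real q ^ (m - 1 - (a * t + jumps 3 k (A + 2) (2 * A + 1) t))) =
            F + (real q - 1) * ?y"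
          unfolding sum_jumps_three(3)[OF A m3 that] F_def
          by (simp only: right_diff_distrib add_diff_eq)
        then have "real (delta2 q m n) = D - ?y"
          using main(1)[of "A + 2" "2 * A + 1"] that by (simp only: D_minus) simp
        then show ?thesis by linarith
      qed
    qed
    \<comment> \<open>The theorem distinguishes \<open>q\<close> modulo 3, the jump positions
      \<open>k = q - 1\<close>, so the remainders are shifted by one.\<close>
    have mod: "[q = 1] (mod 3) \<Longrightarrow> k = 3 * A" "[q = 2] (mod 3) \<Longrightarrow> k = 3 * A + 1"
        "[q = 0] (mod 3) \<Longrightarrow> k = 3 * A + 2"
      unfolding cong_def A_def q by presburger+
    have "k = 3 * A \<or> k = 3 * A + 1 \<or> k = 3 * A + 2" unfolding A_def by presburger
    then have "card (cyclotomic_coset q m n (delta2 q m n)) = m"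
      using main(2) by blast
    then show ?thesis unfolding Let_def D unfolding k_def[symmetric] A_def[symmetric]
      using mod sums by blast
  qed
  show ?thesis using goal1 goal2 goal3 by blast
qed

end
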